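(* Let $N\ge1$. Let $a:\mathbb{R}^N\times\mathbb{R}^N\to\mathbb{R}$ be uniformly continuous and $H\in C(\mathbb{R}^N\times\mathbb{R}^N\times\mathbb{R}^N)$. Assume: (1) there is $a_0>0$ with $a_0\le a(x,y)\le a_0^{-1}$ for all $x,y\in\mathbb{R}^N$; (2) $|H(\cdot,\cdot,0)|_\infty<+\infty$, $|a|_\infty<+\infty$, and $a(x,\cdot)$, $H(x,\cdot,p)$ are $\mathbb{Z}^N$-periodic for all $x,p\in\mathbb{R}^N$; (3) there exist $b_0,C_0>0$, $m>1$ such that $\mu H(x,y,\mu^{-1}p)-H(x,y,p)\ge(1-\mu)(b_0|p|^m-C_0)$ for all $\mu\in(0,1)$ and all $x,y,p\in\mathbb{R}^N$; (4) there is a modulus of continuity $\omega$ such that for all $R>0$, all $x,x',y,y'\in\mathbb{R}^N$ and all $p,p'\in\mathbb{R}^N$ with $|p|,|p'|\le R$, $$|H(x,y,p)-H(x',y',p')|\le\omega(|x-x'|+|y-y'|)(1+R^m)+\omega(|p-p'|)(1+R^{m-1}).$$ Then for all $x,p\in\mathbb{R}^N$, $l\in\mathbb{R}$ there exists a unique constant $c=\bar H(x,p,l)$ such that the cell problem $$-a(x,y)l+H(x,y,p+D\psi(y))=c,\qquad y\in\mathbb{T}^N,$$ has a Lipschitz continuous viscosity solution $\psi$.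
   Context: A modulus of continuity is a nondecreasing function $\omega:[0,\infty)\to[0,\infty)$ with $\omega(t)\to\omega(0)=0$ as $t\to0^+$. $\mathbb{T}^N=\mathbb{R}^N/\mathbb{Z}^N$; functions on $\mathbb{T}^N$ are identified with $\mathbb{Z}^N$-periodic functions on $\mathbb{R}^N$. Viscosity solution is in the usual sense for first-order Hamilton–Jacobi equations. *)

theory Defs
  imports "HOL-Analysis.Analysis"
begin

definition modulus_of_continuity :: "(real \<Rightarrow> real) \<Rightarrow> bool" where
  "modulus_of_continuity \<omega> \<longleftrightarrow>
     mono_on {0..} \<omega> \<and> (\<forall>t\<ge>0. 0 \<le> \<omega> t) \<and> \<omega> 0 = 0 \<and> (\<omega> \<longlongrightarrow> 0) (at_right 0)"

definition Z_periodic :: "(real ^ 'n \<Rightarrow> real) \<Rightarrow> bool" where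
  "Z_periodic f \<longleftrightarrow> (\<forall>y k. (\<forall>i. k $ i \<in> \<int>) \<longrightarrow> f (y + k) = f y)"

text \<open>
  Viscosity sub- and supersolutions of \<open>F(y, u(y), Du(y)) = 0\<close> on the whole space, tested
  with \<open>\<phi> \<in> C\<^sup>1\<close> (whose gradient is \<open>G\<close>) at local extrema of \<open>u - \<phi>\<close>. The first conjunct
  is upper (lower) semicontinuity of \<open>u\<close>. An equation on the torus is read as an equation on
  the whole space for a periodic unknown.
\<close>

definition viscosity_subsolution ::
    "('a::euclidean_space \<Rightarrow> real \<Rightarrow> 'a \<Rightarrow> real) \<Rightarrow> ('a \<Rightarrow> real) \<Rightarrow> bool" where
  "viscosity_subsolution F u \<longleftrightarrow>
     (\<forall>y. \<forall>s > u y. eventually (\<lambda>z. u z < s) (nhds y)) \<and>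
     (\<forall>\<phi> G y. (\<forall>z. GDERIV \<phi> z :> G z) \<longrightarrow> continuous_on UNIV G \<longrightarrow>
        eventually (\<lambda>z. u z - \<phi> z \<le> u y - \<phi> y) (nhds y) \<longrightarrow> F y (u y) (G y) \<le> 0)"

definition viscosity_supersolution ::
    "('a::euclidean_space \<Rightarrow> real \<Rightarrow> 'a \<Rightarrow> real) \<Rightarrow> ('a \<Rightarrow> real) \<Rightarrow> bool" where
  "viscosity_supersolution F u \<longleftrightarrow>
     (\<forall>y. \<forall>s < u y. eventually (\<lambda>z. s < u z) (nhds y)) \<and>
     (\<forall>\<phi> G y. (\<forall>z. GDERIV \<phi> z :> G z) \<longrightarrow> continuous_on UNIV G \<longrightarrow>
        eventually (\<lambda>z. u y - \<phi> y \<le> u z - \<phi> z) (nhds y) \<longrightarrow> 0 \<le> F y (u y) (G y))"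

definition viscosity_solution ::
    "('a::euclidean_space \<Rightarrow> real \<Rightarrow> 'a \<Rightarrow> real) \<Rightarrow> ('a \<Rightarrow> real) \<Rightarrow> bool" where
  "viscosity_solution F u \<longleftrightarrow> viscosity_subsolution F u \<and> viscosity_supersolution F u"

end

theory Submission
  imports Defs "HOL-Complex_Analysis.Great_Picard" "HOL-Real_Asymp.Real_Asymp"
begin

text \<open>
  With \<open>x\<close>, \<open>p\<close>, \<open>l\<close> fixed, \<open>G y q = - a x y * l + H x y (p + q)\<close> is continuous, periodic in \<open>y\<close>
  and coercive in \<open>q\<close>, and the argument of Lions, Papanicolaou and Varadhan applies.
  For \<open>\<delta> > 0\<close> the equation \<open>\<delta> u + G(y, Du) = 0\<close> is solved by the supremum of all subsolutions
  between \<open>- M / \<delta>\<close> and \<open>M / \<delta>\<close>, where \<open>M = sup |G(\<cdot>, 0)|\<close>. Coercivity makes all of them Lipschitz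
  with a constant independent of \<open>\<delta>\<close>, and the supremum is periodic because the family is invariant
  under integer translations. As \<open>\<delta> \<rightarrow> 0\<close>, subsequences of \<open>u - u(0)\<close> and \<open>- \<delta> u(0)\<close> converge to a
  solution and the constant of the cell problem. Uniqueness of the constant follows by doubling
  variables.
\<close>

section \<open>Test functions\<close>

definition has_continuous_gradient :: "('a::real_inner \<Rightarrow> real) \<Rightarrow> ('a \<Rightarrow> 'a) \<Rightarrow> bool" where
  "has_continuous_gradient \<phi> D \<longleftrightarrow> (\<forall>z. GDERIV \<phi> z :> D z) \<and> continuous_on UNIV D"

lemma has_continuous_gradient_imp_continuous_on:
  assumes "has_continuous_gradient \<phi> D"
  shows "continuous_on A \<phi>"
proof -
  have "isCont \<phi> z" for z
    using assms unfolding has_continuous_gradient_def gderiv_def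
    by (blast intro: has_derivative_continuous)
  then show ?thesis by (simp add: continuous_at_imp_continuous_on)
qed

lemma has_continuous_gradient_add_const:
  assumes "has_continuous_gradient \<phi> D"
  shows "has_continuous_gradient (\<lambda>z. \<phi> z + k) D"
  using assms GDERIV_add[OF _ GDERIV_const] unfolding has_continuous_gradient_def by fastforce

lemma has_continuous_gradient_add:
  assumes "has_continuous_gradient \<phi> D" and "has_continuous_gradient \<psi> E"
  shows "has_continuous_gradient (\<lambda>z. \<phi> z + \<psi> z) (\<lambda>z. D z + E z)"
  using assms unfolding has_continuous_gradient_def
  by (auto intro: GDERIV_add continuous_intros)

lemma has_continuous_gradient_uminus:
  assumes "has_continuous_gradient \<phi> D"
  shows "has_continuous_gradient (\<lambda>z. - \<phi> z) (\<lambda>z. - D z)"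
  using assms unfolding has_continuous_gradient_def
  by (auto intro: GDERIV_minus continuous_intros)

lemma has_continuous_gradient_translate:
  assumes "has_continuous_gradient \<phi> D"
  shows "has_continuous_gradient (\<lambda>z. \<phi> (z + k)) (\<lambda>z. D (z + k))"
proof -
  have "GDERIV (\<lambda>z. \<phi> (z + k)) z :> D (z + k)" for z
  proof -
    have "(\<phi> has_derivative (\<lambda>h. h \<bullet> D (z + k))) (at (z + k))"
      using assms by (simp add: has_continuous_gradient_def gderiv_def)
    moreover have "((\<lambda>z. z + k) has_derivative (\<lambda>h. h)) (at z)"
      by (auto intro!: derivative_eq_intros)
    ultimately have "(\<phi> \<circ> (\<lambda>z. z + k) has_derivative (\<lambda>h. h \<bullet> D (z + k)) \<circ> (\<lambda>h. h)) (at z)"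
      by (intro diff_chain_at)
    then show ?thesis by (simp add: gderiv_def o_def)
  qed
  moreover have "continuous_on UNIV (\<lambda>z. D (z + k))"
    by (rule continuous_on_compose2[of UNIV D])
      (use assms in \<open>auto simp: has_continuous_gradient_def intro: continuous_intros\<close>)
  ultimately show ?thesis by (simp add: has_continuous_gradient_def)
qed

lemma has_continuous_gradient_quadratic:
  "has_continuous_gradient (\<lambda>z. N * (norm (z - x))\<^sup>2) (\<lambda>z. (2 * N) *\<^sub>R (z - x))"
proof -
  have "GDERIV (\<lambda>z. N * (norm (z - x))\<^sup>2) z :> (2 * N) *\<^sub>R (z - x)" for z
    unfolding gderiv_def power2_norm_eq_inner
    by (auto intro!: derivative_eq_intros simp: inner_commute algebra_simps)
  then show ?thesis
    unfolding has_continuous_gradient_def by (auto intro!: continuous_intros)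
qed

definition smoothed_norm :: "real \<Rightarrow> 'a::real_inner \<Rightarrow> real" where
  "smoothed_norm \<eta> z = sqrt ((norm z)\<^sup>2 + \<eta>\<^sup>2)"

lemma smoothed_norm_0: "smoothed_norm \<eta> 0 = \<bar>\<eta>\<bar>"
  by (simp add: smoothed_norm_def)

lemma norm_le_smoothed_norm: "norm z \<le> smoothed_norm \<eta> z"
  unfolding smoothed_norm_def by (intro real_le_rsqrt) simp

lemma smoothed_norm_pos:
  assumes "\<eta> > 0"
  shows "smoothed_norm \<eta> z > 0"
  unfolding smoothed_norm_def using assms by (simp add: add_nonneg_pos)

lemma has_continuous_gradient_smoothed_norm:
  assumes "\<eta> > 0"
  shows "has_continuous_gradient (\<lambda>z. K * smoothed_norm \<eta> (z - x))
    (\<lambda>z. (K / smoothed_norm \<eta> (z - x)) *\<^sub>R (z - x))"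
proof -
  have pos: "(z - x) \<bullet> (z - x) + \<eta>\<^sup>2 > 0" for z
    using assms by (simp add: add_nonneg_pos)
  have "GDERIV (\<lambda>z. K * smoothed_norm \<eta> (z - x)) z :> (K / smoothed_norm \<eta> (z - x)) *\<^sub>R (z - x)"
    for z
    unfolding gderiv_def smoothed_norm_def power2_norm_eq_inner
    using pos[of z]
    by (auto intro!: derivative_eq_intros simp: inner_commute divide_simps)
  moreover have "continuous_on UNIV (\<lambda>z. (K / smoothed_norm \<eta> (z - x)) *\<^sub>R (z - x))"
    using smoothed_norm_pos[OF assms, THEN less_imp_neq, symmetric]
    unfolding smoothed_norm_def by (intro continuous_intros ballI)
  ultimately show ?thesis by (simp add: has_continuous_gradient_def)
qed

section \<open>Semidifferentials\<close>

definition superdifferential :: "('a::real_inner \<Rightarrow> real) \<Rightarrow> 'a \<Rightarrow> 'a set" where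
  "superdifferential u y =
     {D y |\<phi> D. has_continuous_gradient \<phi> D \<and> (\<forall>\<^sub>F z in nhds y. u z - \<phi> z \<le> u y - \<phi> y)}"

definition subdifferential :: "('a::real_inner \<Rightarrow> real) \<Rightarrow> 'a \<Rightarrow> 'a set" where
  "subdifferential u y =
     {D y |\<phi> D. has_continuous_gradient \<phi> D \<and> (\<forall>\<^sub>F z in nhds y. u y - \<phi> y \<le> u z - \<phi> z)}"

lemma superdifferentialI:
  assumes "has_continuous_gradient \<phi> D" and "\<forall>\<^sub>F z in nhds y. u z - \<phi> z \<le> u y - \<phi> y" and "D y = p"
  shows "p \<in> superdifferential u y"
  using assms unfolding superdifferential_def by blast

lemma superdifferentialI_open:
  assumes \<phi>: "has_continuous_gradient \<phi> D" and S: "open S" "y \<in> S"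
    and max: "\<And>z. z \<in> S \<Longrightarrow> u z - \<phi> z \<le> u y - \<phi> y"
  shows "D y \<in> superdifferential u y"
proof (rule superdifferentialI[OF \<phi> _ refl])
  show "\<forall>\<^sub>F z in nhds y. u z - \<phi> z \<le> u y - \<phi> y"
    using eventually_nhds_in_open[OF S] by (rule eventually_mono) (rule max)
qed

lemma superdifferentialE:
  assumes "p \<in> superdifferential u y"
  obtains \<phi> D where "has_continuous_gradient \<phi> D" "\<forall>\<^sub>F z in nhds y. u z - \<phi> z \<le> u y - \<phi> y" "D y = p"
  using assms unfolding superdifferential_def by blast

lemma subdifferentialI:
  assumes "has_continuous_gradient \<phi> D" and "\<forall>\<^sub>F z in nhds y. u y - \<phi> y \<le> u z - \<phi> z" and "D y = p"
  shows "p \<in> subdifferential u y"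
  using assms unfolding subdifferential_def by blast

lemma subdifferentialE:
  assumes "p \<in> subdifferential u y"
  obtains \<phi> D where "has_continuous_gradient \<phi> D" "\<forall>\<^sub>F z in nhds y. u y - \<phi> y \<le> u z - \<phi> z" "D y = p"
  using assms unfolding subdifferential_def by blast

lemma mem_subdifferential_iff_uminus:
  "p \<in> subdifferential u y \<longleftrightarrow> - p \<in> superdifferential (\<lambda>z. - u z) y"
proof
  assume "p \<in> subdifferential u y"
  then obtain \<phi> D where \<phi>: "has_continuous_gradient \<phi> D" "D y = p"
    and min: "\<forall>\<^sub>F z in nhds y. u y - \<phi> y \<le> u z - \<phi> z"
    by (rule subdifferentialE)
  from min have "\<forall>\<^sub>F z in nhds y. - u z - - \<phi> z \<le> - u y - - \<phi> y"
    by (rule eventually_mono) simp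
  then show "- p \<in> superdifferential (\<lambda>z. - u z) y"
    by (rule superdifferentialI[OF has_continuous_gradient_uminus[OF \<phi>(1)]]) (simp add: \<phi>(2))
next
  assume "- p \<in> superdifferential (\<lambda>z. - u z) y"
  then obtain \<phi> D where \<phi>: "has_continuous_gradient \<phi> D" "D y = - p"
    and max: "\<forall>\<^sub>F z in nhds y. - u z - \<phi> z \<le> - u y - \<phi> y"
    by (rule superdifferentialE)
  from max have "\<forall>\<^sub>F z in nhds y. u y - - \<phi> y \<le> u z - - \<phi> z"
    by (rule eventually_mono) simp
  then show "p \<in> subdifferential u y"
    by (rule subdifferentialI[OF has_continuous_gradient_uminus[OF \<phi>(1)]]) (simp add: \<phi>(2))
qed

lemma superdifferential_strict_contact:
  assumes "p \<in> superdifferential u y"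
  obtains \<phi> D r where "has_continuous_gradient \<phi> D" "\<phi> y = u y" "D y = p" "r > 0"
    "\<And>z. dist z y < r \<Longrightarrow> u z + (norm (z - y))\<^sup>2 \<le> \<phi> z"
proof -
  obtain \<phi> D where \<phi>: "has_continuous_gradient \<phi> D" "D y = p"
    and max: "\<forall>\<^sub>F z in nhds y. u z - \<phi> z \<le> u y - \<phi> y"
    using assms by (rule superdifferentialE)
  obtain r where r: "r > 0" "\<And>z. dist z y < r \<Longrightarrow> u z - \<phi> z \<le> u y - \<phi> y"
    using max unfolding eventually_nhds_metric by blast
  have quadratic: "has_continuous_gradient (\<lambda>z. (norm (z - y))\<^sup>2) (\<lambda>z. 2 *\<^sub>R (z - y))"
    using has_continuous_gradient_quadratic[of 1 y] by simp
  show ?thesis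
  proof
    show "has_continuous_gradient (\<lambda>z. (\<phi> z + (norm (z - y))\<^sup>2) + (u y - \<phi> y))
        (\<lambda>z. D z + 2 *\<^sub>R (z - y))"
      by (intro has_continuous_gradient_add_const has_continuous_gradient_add \<phi> quadratic)
    show "u z + (norm (z - y))\<^sup>2 \<le> \<phi> z + (norm (z - y))\<^sup>2 + (u y - \<phi> y)"
      if "dist z y < r" for z
      using r(2)[OF that] by simp
  qed (use r \<phi> in auto)
qed

lemma subdifferential_strict_contact:
  assumes "p \<in> subdifferential u y"
  obtains \<phi> D r where "has_continuous_gradient \<phi> D" "\<phi> y = u y" "D y = p" "r > 0"
    "\<And>z. dist z y < r \<Longrightarrow> \<phi> z + (norm (z - y))\<^sup>2 \<le> u z"
proof -
  have "- p \<in> superdifferential (\<lambda>z. - u z) y"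
    using assms by (simp add: mem_subdifferential_iff_uminus)
  then obtain \<phi> D r where \<phi>: "has_continuous_gradient \<phi> D" "\<phi> y = - u y" "D y = - p" "r > 0"
    and contact: "\<And>z. dist z y < r \<Longrightarrow> - u z + (norm (z - y))\<^sup>2 \<le> \<phi> z"
    by (rule superdifferential_strict_contact) blast
  show ?thesis
  proof (rule that[OF has_continuous_gradient_uminus[OF \<phi>(1)] _ _ \<phi>(4)])
    show "- \<phi> z + (norm (z - y))\<^sup>2 \<le> u z" if "dist z y < r" for z
      using contact[OF that] by linarith
  qed (use \<phi> in auto)
qed

lemma superdifferential_antimono:
  assumes "\<forall>\<^sub>F z in nhds y. u z \<le> w z" and "u y = w y"
  shows "superdifferential w y \<subseteq> superdifferential u y"
proof
  fix p assume "p \<in> superdifferential w y"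
  then obtain \<phi> D where \<phi>: "has_continuous_gradient \<phi> D" "D y = p"
    and max: "\<forall>\<^sub>F z in nhds y. w z - \<phi> z \<le> w y - \<phi> y"
    by (rule superdifferentialE)
  from assms(1) max have "\<forall>\<^sub>F z in nhds y. u z - \<phi> z \<le> u y - \<phi> y"
    unfolding assms(2) by eventually_elim linarith
  with \<phi> show "p \<in> superdifferential u y" by (intro superdifferentialI)
qed

lemma subdifferential_mono:
  assumes "\<forall>\<^sub>F z in nhds y. u z \<le> w z" and "u y = w y"
  shows "subdifferential u y \<subseteq> subdifferential w y"
  using superdifferential_antimono[of "\<lambda>z. - w z" "\<lambda>z. - u z" y] assms
  by (auto simp: mem_subdifferential_iff_uminus)

lemma superdifferential_GDERIV_unique:
  assumes u: "GDERIV u y :> D" and p: "p \<in> superdifferential u y"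
  shows "p = D"
proof -
  obtain \<phi> E where \<phi>: "has_continuous_gradient \<phi> E" "E y = p"
    and max: "\<forall>\<^sub>F z in nhds y. u z - \<phi> z \<le> u y - \<phi> y"
    using p by (rule superdifferentialE)
  obtain S where S: "open S" "y \<in> S" "\<And>z. z \<in> S \<Longrightarrow> u z - \<phi> z \<le> u y - \<phi> y"
    using max unfolding eventually_nhds by blast
  have "((\<lambda>z. u z - \<phi> z) has_derivative (\<lambda>h. h \<bullet> (D - p))) (at y)"
    using GDERIV_diff[OF u, of \<phi> p] \<phi> unfolding gderiv_def has_continuous_gradient_def by blast
  from differential_zero_maxmin[OF S(2,1) this] S(3) have "(\<lambda>h. h \<bullet> (D - p)) = (\<lambda>h. 0)"
    by blast
  then have "(D - p) \<bullet> (D - p) = 0" by metis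
  then show ?thesis by simp
qed

lemma superdifferential_constD: "p \<in> superdifferential (\<lambda>z. k) y \<Longrightarrow> p = 0"
  by (rule superdifferential_GDERIV_unique[OF GDERIV_const])

lemma subdifferential_constD: "p \<in> subdifferential (\<lambda>z. k) y \<Longrightarrow> p = 0"
  using superdifferential_constD[of "- p"] by (simp add: mem_subdifferential_iff_uminus)

lemma superdifferential_diff_const: "superdifferential (\<lambda>z. u z - k) y = superdifferential u y"
  by (simp add: superdifferential_def algebra_simps)

lemma subdifferential_diff_const: "subdifferential (\<lambda>z. u z - k) y = subdifferential u y"
  by (simp add: subdifferential_def algebra_simps)

lemma superdifferential_translate_subset:
  "superdifferential (\<lambda>z. u (z + k)) y \<subseteq> superdifferential u (y + k)"
proof
  fix p assume "p \<in> superdifferential (\<lambda>z. u (z + k)) y"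
  then obtain \<phi> D where \<phi>: "has_continuous_gradient \<phi> D" "D y = p"
    and max: "\<forall>\<^sub>F z in nhds y. u (z + k) - \<phi> z \<le> u (y + k) - \<phi> y"
    by (rule superdifferentialE)
  have "filterlim (\<lambda>z. z - k) (nhds (y + k - k)) (nhds (y + k))"
    by (intro tendsto_intros filterlim_ident)
  then have "filterlim (\<lambda>z. z - k) (nhds y) (nhds (y + k))" by simp
  from eventually_compose_filterlim[OF max this]
  have "\<forall>\<^sub>F z in nhds (y + k). u z - \<phi> (z - k) \<le> u (y + k) - \<phi> y" by simp
  then show "p \<in> superdifferential u (y + k)"
    using \<phi>
    by (intro superdifferentialI[OF has_continuous_gradient_translate[of \<phi> D "- k"]]) auto
qed

section \<open>Viscosity solutions\<close>

lemma continuous_on_imp_eventually_less: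
  fixes u :: "'a::topological_space \<Rightarrow> real"
  assumes "continuous_on UNIV u" "u y < s"
  shows "\<forall>\<^sub>F z in nhds y. u z < s"
proof -
  have "open {z. u z < s}"
    using assms(1) by (intro open_Collect_less continuous_intros)
  then show ?thesis
    using assms(2) unfolding eventually_nhds by blast
qed

lemma viscosity_subsolutionD:
  assumes "viscosity_subsolution F u" and "p \<in> superdifferential u y"
  shows "F y (u y) p \<le> 0"
  using assms
  unfolding viscosity_subsolution_def superdifferential_def has_continuous_gradient_def by blast

lemma viscosity_supersolutionD:
  assumes "viscosity_supersolution F u" and "p \<in> subdifferential u y"
  shows "0 \<le> F y (u y) p"
  using assms
  unfolding viscosity_supersolution_def subdifferential_def has_continuous_gradient_def by blast

lemma viscosity_subsolutionI:
  assumes "continuous_on UNIV u" and "\<And>y p. p \<in> superdifferential u y \<Longrightarrow> F y (u y) p \<le> 0"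
  shows "viscosity_subsolution F u"
  using assms continuous_on_imp_eventually_less[OF assms(1)]
  unfolding viscosity_subsolution_def superdifferential_def has_continuous_gradient_def by blast

lemma viscosity_supersolution_iff_uminus:
  assumes "continuous_on UNIV u"
  shows "viscosity_supersolution F u \<longleftrightarrow>
    viscosity_subsolution (\<lambda>y r q. - F y (- r) (- q)) (\<lambda>y. - u y)"
proof -
  have "\<forall>\<^sub>F z in nhds y. s < u z" if "s < u y" for s y
    using continuous_on_imp_eventually_less[of "\<lambda>z. - u z" y "- s"] assms that
    by (simp add: continuous_on_minus)
  then have "viscosity_supersolution F u \<longleftrightarrow> (\<forall>y. \<forall>p\<in>subdifferential u y. 0 \<le> F y (u y) p)"
    unfolding viscosity_supersolution_def subdifferential_def has_continuous_gradient_def by blast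
  also have "\<dots> \<longleftrightarrow> (\<forall>y. \<forall>p\<in>superdifferential (\<lambda>z. - u z) y. - F y (u y) (- p) \<le> 0)"
    by (auto simp: mem_subdifferential_iff_uminus) (metis minus_minus)
  also have "\<dots> \<longleftrightarrow> viscosity_subsolution (\<lambda>y r q. - F y (- r) (- q)) (\<lambda>y. - u y)"
    using viscosity_subsolutionD[of _ "\<lambda>y. - u y"]
      viscosity_subsolutionI[OF continuous_on_minus[OF assms], of "\<lambda>y r q. - F y (- r) (- q)"]
    by fastforce
  finally show ?thesis .
qed

lemma viscosity_supersolutionI:
  assumes "continuous_on UNIV u" and "\<And>y p. p \<in> subdifferential u y \<Longrightarrow> 0 \<le> F y (u y) p"
  shows "viscosity_supersolution F u"
  unfolding viscosity_supersolution_iff_uminus[OF assms(1)]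
  using assms
  by (intro viscosity_subsolutionI)
    (auto intro: continuous_intros simp: mem_subdifferential_iff_uminus)

lemma viscosity_subsolution_const:
  assumes "\<And>y. F y k 0 \<le> 0"
  shows "viscosity_subsolution F (\<lambda>y. k)"
  using assms superdifferential_constD[of _ k]
  by (intro viscosity_subsolutionI continuous_on_const) blast

lemma viscosity_supersolution_const:
  assumes "\<And>y. 0 \<le> F y k 0"
  shows "viscosity_supersolution F (\<lambda>y. k)"
  using assms subdifferential_constD[of _ k]
  by (intro viscosity_supersolutionI continuous_on_const) blast

lemma viscosity_subsolution_diff_const:
  assumes "continuous_on UNIV u" and "viscosity_subsolution F u"
  shows "viscosity_subsolution (\<lambda>y r q. F y (r + k) q) (\<lambda>y. u y - k)"
  using assms viscosity_subsolutionD[OF assms(2)]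
  by (intro viscosity_subsolutionI)
    (auto intro: continuous_intros simp: superdifferential_diff_const)

lemma viscosity_supersolution_diff_const:
  assumes "continuous_on UNIV u" and "viscosity_supersolution F u"
  shows "viscosity_supersolution (\<lambda>y r q. F y (r + k) q) (\<lambda>y. u y - k)"
  using assms viscosity_supersolutionD[OF assms(2)]
  by (intro viscosity_supersolutionI)
    (auto intro: continuous_intros simp: subdifferential_diff_const)

lemma viscosity_subsolution_translate:
  assumes "continuous_on UNIV u" and "viscosity_subsolution F u"
    and F: "\<And>y r q. F (y + k) r q = F y r q"
  shows "viscosity_subsolution F (\<lambda>y. u (y + k))"
proof (rule viscosity_subsolutionI)
  show "continuous_on UNIV (\<lambda>y. u (y + k))"
    by (rule continuous_on_compose2[OF assms(1)]) (auto intro: continuous_intros)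
  show "F y (u (y + k)) p \<le> 0" if "p \<in> superdifferential (\<lambda>y. u (y + k)) y" for y p
    using viscosity_subsolutionD[OF assms(2) subsetD[OF superdifferential_translate_subset that]]
    by (simp add: F)
qed

section \<open>Stability\<close>

text \<open>
  Only a one-sided bound on \<open>v n - u\<close> is assumed away from \<open>y\<close>, here and below, so that suprema
  are covered as well as uniform limits.
\<close>

lemma maximizers_converge_to_strict_contact:
  fixes u :: "'a::euclidean_space \<Rightarrow> real"
  assumes r: "r > 0" and \<phi>_cont: "continuous_on UNIV \<phi>" and \<phi>_y: "\<phi> y = u y"
    and contact: "\<And>z. dist z y < r \<Longrightarrow> u z + (norm (z - y))\<^sup>2 \<le> \<phi> z"
    and v_le: "\<And>e. e > 0 \<Longrightarrow> \<forall>\<^sub>F n in sequentially. \<forall>z. v n z \<le> u z + e"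
    and v_lim: "(\<lambda>n. v n y) \<longlonglongrightarrow> u y"
    and z: "\<And>n. dist (z n) y < r" and z_max: "\<And>n. v n y - \<phi> y \<le> v n (z n) - \<phi> (z n)"
  shows "z \<longlonglongrightarrow> y" and "(\<lambda>n. v n (z n)) \<longlonglongrightarrow> u y"
proof -
  have near: "\<forall>\<^sub>F n in sequentially. (norm (z n - y))\<^sup>2 < e \<and> \<bar>v n (z n) - \<phi> (z n)\<bar> < e"
    if e: "e > 0" for e
  proof -
    have "\<forall>\<^sub>F n in sequentially. dist (v n y) (u y) < e / 3"
      using e by (intro tendstoD[OF v_lim]) simp
    moreover have "\<forall>\<^sub>F n in sequentially. \<forall>z. v n z \<le> u z + e / 3"
      using e by (intro v_le) simp
    ultimately show ?thesis
    proof eventually_elim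
      case (elim n)
      have "v n (z n) - \<phi> (z n) \<le> e / 3 - (norm (z n - y))\<^sup>2"
        using contact[OF z[of n]] elim(2)[rule_format, of "z n"] by linarith
      moreover have "- (e / 3) < v n (z n) - \<phi> (z n)"
        using z_max[of n] elim(1) unfolding dist_real_def \<phi>_y by linarith
      moreover have "0 \<le> (norm (z n - y))\<^sup>2" by simp
      ultimately show ?case using e by linarith
    qed
  qed
  have "(\<lambda>n. (norm (z n - y))\<^sup>2) \<longlonglongrightarrow> 0"
    by (rule tendstoI, rule eventually_mono[OF near]) auto
  then have "(\<lambda>n. sqrt ((norm (z n - y))\<^sup>2)) \<longlonglongrightarrow> sqrt 0" by (rule tendsto_real_sqrt)
  then show z_lim: "z \<longlonglongrightarrow> y" by (simp add: tendsto_norm_zero_iff LIM_zero_iff)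
  have "(\<lambda>n. v n (z n) - \<phi> (z n)) \<longlonglongrightarrow> 0"
    by (rule tendstoI, rule eventually_mono[OF near]) auto
  moreover have "(\<lambda>n. \<phi> (z n)) \<longlonglongrightarrow> \<phi> y"
    by (rule continuous_on_tendsto_compose[OF \<phi>_cont z_lim]) auto
  ultimately have "(\<lambda>n. v n (z n) - \<phi> (z n) + \<phi> (z n)) \<longlonglongrightarrow> 0 + \<phi> y" by (rule tendsto_add)
  then show "(\<lambda>n. v n (z n)) \<longlonglongrightarrow> u y" by (simp add: \<phi>_y)
qed

lemma superdifferential_limit:
  fixes u :: "'a::euclidean_space \<Rightarrow> real"
  assumes p: "p \<in> superdifferential u y"
    and v_cont: "\<And>n. continuous_on UNIV (v n)"
    and v_le: "\<And>e. e > 0 \<Longrightarrow> \<forall>\<^sub>F n in sequentially. \<forall>z. v n z \<le> u z + e"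
    and v_lim: "(\<lambda>n. v n y) \<longlonglongrightarrow> u y"
  obtains z q where "z \<longlonglongrightarrow> y" "(\<lambda>n. v n (z n)) \<longlonglongrightarrow> u y" "q \<longlonglongrightarrow> p"
    "\<forall>\<^sub>F n in sequentially. q n \<in> superdifferential (v n) (z n)"
proof -
  obtain \<phi> D r where \<phi>: "has_continuous_gradient \<phi> D" "\<phi> y = u y" "D y = p" and r: "r > 0"
    and contact: "\<And>z. dist z y < r \<Longrightarrow> u z + (norm (z - y))\<^sup>2 \<le> \<phi> z"
    using p by (rule superdifferential_strict_contact) blast
  have \<phi>_cont: "continuous_on A \<phi>" for A
    using \<phi>(1) by (rule has_continuous_gradient_imp_continuous_on)
  have "\<exists>z\<in>cball y (r / 2). \<forall>w\<in>cball y (r / 2). v n w - \<phi> w \<le> v n z - \<phi> z" for n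
    using r by (intro continuous_attains_sup continuous_intros \<phi>_cont
        continuous_on_subset[OF v_cont]) auto
  then obtain z where z: "\<And>n. z n \<in> cball y (r / 2)"
    and z_max: "\<And>n w. w \<in> cball y (r / 2) \<Longrightarrow> v n w - \<phi> w \<le> v n (z n) - \<phi> (z n)"
    by metis
  have z_near: "dist (z n) y < r" and z_above: "v n y - \<phi> y \<le> v n (z n) - \<phi> (z n)" for n
    using z[of n] z_max[of y n] r by (auto simp: dist_commute)
  have lim: "z \<longlonglongrightarrow> y" "(\<lambda>n. v n (z n)) \<longlonglongrightarrow> u y"
    by (rule maximizers_converge_to_strict_contact
        [OF r \<phi>_cont \<phi>(2) contact v_le v_lim z_near z_above]; assumption)+
  have "continuous_on UNIV D" using \<phi>(1) by (simp add: has_continuous_gradient_def)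
  from continuous_on_tendsto_compose[OF this lim(1)] have "(\<lambda>n. D (z n)) \<longlonglongrightarrow> p"
    by (simp add: \<phi>(3))
  moreover have "\<forall>\<^sub>F n in sequentially. dist (z n) y < r / 2"
    by (rule tendstoD[OF lim(1)]) (use r in simp)
  then have "\<forall>\<^sub>F n in sequentially. D (z n) \<in> superdifferential (v n) (z n)"
  proof eventually_elim
    case (elim n)
    then have "z n \<in> ball y (r / 2)" by (simp add: dist_commute)
    with \<phi>(1) open_ball show ?case by (rule superdifferentialI_open) (intro z_max, simp)
  qed
  ultimately show ?thesis using lim that by blast
qed

lemma viscosity_subsolution_limitD:
  fixes u :: "'a::euclidean_space \<Rightarrow> real"
  assumes p: "p \<in> superdifferential u y"
    and v: "\<And>n. continuous_on UNIV (v n)" "\<And>n. viscosity_subsolution (F n) (v n)"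
    and v_le: "\<And>e. e > 0 \<Longrightarrow> \<forall>\<^sub>F n in sequentially. \<forall>z. v n z \<le> u z + e"
    and v_lim: "(\<lambda>n. v n y) \<longlonglongrightarrow> u y"
    and F: "\<And>z r q. z \<longlonglongrightarrow> y \<Longrightarrow> r \<longlonglongrightarrow> u y \<Longrightarrow> q \<longlonglongrightarrow> p \<Longrightarrow>
      (\<lambda>n. F n (z n) (r n) (q n)) \<longlonglongrightarrow> F' y (u y) p"
  shows "F' y (u y) p \<le> 0"
proof -
  obtain z q where "z \<longlonglongrightarrow> y" "(\<lambda>n. v n (z n)) \<longlonglongrightarrow> u y" "q \<longlonglongrightarrow> p"
    and q: "\<forall>\<^sub>F n in sequentially. q n \<in> superdifferential (v n) (z n)"
    by (rule superdifferential_limit[OF p v(1) v_le v_lim])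
  then have "(\<lambda>n. F n (z n) (v n (z n)) (q n)) \<longlonglongrightarrow> F' y (u y) p" by (intro F)
  moreover have "\<forall>\<^sub>F n in sequentially. F n (z n) (v n (z n)) (q n) \<le> 0"
    using q by (rule eventually_mono) (rule viscosity_subsolutionD[OF v(2)])
  ultimately show ?thesis by (intro tendsto_upperbound) auto
qed

lemma viscosity_subsolution_uniform_limit:
  fixes u :: "'a::euclidean_space \<Rightarrow> real"
  assumes v: "\<And>n. continuous_on UNIV (v n)" "\<And>n. viscosity_subsolution (F n) (v n)"
    and lim: "uniform_limit UNIV v u sequentially"
    and F: "\<And>z r q y s p. z \<longlonglongrightarrow> y \<Longrightarrow> r \<longlonglongrightarrow> s \<Longrightarrow> q \<longlonglongrightarrow> p \<Longrightarrow>
      (\<lambda>n. F n (z n) (r n) (q n)) \<longlonglongrightarrow> F' y s p"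
  shows "viscosity_subsolution F' u"
proof (rule viscosity_subsolutionI)
  show "continuous_on UNIV u"
    using lim by (rule uniform_limit_theorem[rotated]) (auto simp: v)
next
  fix y p assume p: "p \<in> superdifferential u y"
  have v_le: "\<forall>\<^sub>F n in sequentially. \<forall>z. v n z \<le> u z + e" if "e > 0" for e
    using uniform_limitD[OF lim that]
    by (rule eventually_mono) (auto simp: dist_real_def abs_less_iff algebra_simps less_imp_le)
  have v_lim: "(\<lambda>n. v n y) \<longlonglongrightarrow> u y" using lim by (rule tendsto_uniform_limitI) simp
  show "F' y (u y) p \<le> 0"
    by (rule viscosity_subsolution_limitD[OF p v v_le v_lim F])
qed

lemma viscosity_supersolution_uniform_limit:
  fixes u :: "'a::euclidean_space \<Rightarrow> real"
  assumes v: "\<And>n. continuous_on UNIV (v n)" "\<And>n. viscosity_supersolution (F n) (v n)"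
    and lim: "uniform_limit UNIV v u sequentially"
    and F: "\<And>z r q y s p. z \<longlonglongrightarrow> y \<Longrightarrow> r \<longlonglongrightarrow> s \<Longrightarrow> q \<longlonglongrightarrow> p \<Longrightarrow>
      (\<lambda>n. F n (z n) (r n) (q n)) \<longlonglongrightarrow> F' y s p"
  shows "viscosity_supersolution F' u"
proof -
  have "continuous_on UNIV u"
    using lim by (rule uniform_limit_theorem[rotated]) (auto simp: v)
  moreover have "viscosity_subsolution (\<lambda>y r q. - F' y (- r) (- q)) (\<lambda>y. - u y)"
  proof (rule viscosity_subsolution_uniform_limit)
    show "viscosity_subsolution (\<lambda>y r q. - F n y (- r) (- q)) (\<lambda>y. - v n y)" for n
      using v by (simp add: viscosity_supersolution_iff_uminus)
    show "uniform_limit UNIV (\<lambda>n y. - v n y) (\<lambda>y. - u y) sequentially"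
      by (rule uniform_limit_uminus[OF lim])
  qed (intro continuous_intros tendsto_minus v F; assumption)+
  ultimately show ?thesis by (simp add: viscosity_supersolution_iff_uminus)
qed

lemma viscosity_subsolution_SUP:
  fixes F :: "'a::euclidean_space \<Rightarrow> real \<Rightarrow> 'a \<Rightarrow> real"
  assumes F_cont: "continuous_on UNIV (\<lambda>(y, r, q). F y r q)"
    and S: "S \<noteq> {}" "\<And>v. v \<in> S \<Longrightarrow> continuous_on UNIV v" "\<And>v. v \<in> S \<Longrightarrow> viscosity_subsolution F v"
    and bdd: "\<And>y. bdd_above ((\<lambda>v. v y) ` S)"
    and u_def: "\<And>y. u y = (SUP v\<in>S. v y)" and u_cont: "continuous_on UNIV u"
  shows "viscosity_subsolution F u"
proof (rule viscosity_subsolutionI[OF u_cont])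
  fix y p assume p: "p \<in> superdifferential u y"
  have upper: "v z \<le> u z" if "v \<in> S" for v z
    unfolding u_def by (rule cSUP_upper[OF that bdd])
  have "\<exists>v\<in>S. u y - inverse (real (Suc n)) < v y" for n
    using less_cSUP_iff[OF S(1) bdd, of "u y - inverse (real (Suc n))" y] by (simp add: u_def)
  then obtain v where v: "\<And>n. v n \<in> S" "\<And>n. u y - inverse (real (Suc n)) < v n y" by metis
  have v_le: "\<forall>\<^sub>F n in sequentially. \<forall>z. v n z \<le> u z + e" if "e > 0" for e
    using upper[OF v(1)] that by (intro always_eventually allI add_increasing2) auto
  have "(\<lambda>n. u y - inverse (real (Suc n))) \<longlonglongrightarrow> u y - 0"
    by (intro tendsto_intros LIMSEQ_inverse_real_of_nat)
  then have lower_lim: "(\<lambda>n. u y - inverse (real (Suc n))) \<longlonglongrightarrow> u y" by simp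
  have v_lim: "(\<lambda>n. v n y) \<longlonglongrightarrow> u y"
    by (rule tendsto_sandwich[OF _ _ lower_lim tendsto_const])
      (use v upper in \<open>auto intro: always_eventually less_imp_le\<close>)
  show "F y (u y) p \<le> 0"
  proof (rule viscosity_subsolution_limitD[OF p S(2)[OF v(1)] S(3)[OF v(1)] v_le v_lim])
    show "(\<lambda>n. F (z n) (r n) (q n)) \<longlonglongrightarrow> F y (u y) p"
      if "z \<longlonglongrightarrow> y" "r \<longlonglongrightarrow> u y" "q \<longlonglongrightarrow> p" for z r q
      using continuous_on_tendsto_compose
        [OF F_cont tendsto_Pair[OF that(1) tendsto_Pair[OF that(2,3)]]] by simp
  qed
qed

section \<open>Lipschitz bounds from superdifferentials\<close>

lemma continuous_attains_global_max:
  fixes f :: "'a::topological_space \<Rightarrow> real"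
  assumes "compact K" and "continuous_on K f" and dominated: "\<And>w. \<exists>k\<in>K. f w \<le> f k"
  obtains z where "z \<in> K" "\<And>w. f w \<le> f z"
proof -
  have "K \<noteq> {}" using dominated by blast
  from continuous_attains_sup[OF assms(1) this assms(2)]
  obtain z where "z \<in> K" "\<And>k. k \<in> K \<Longrightarrow> f k \<le> f z" by blast
  then show ?thesis using dominated that by (meson order_trans)
qed

lemma superdifferential_smoothed_cone:
  fixes v :: "'a::euclidean_space \<Rightarrow> real"
  assumes cont: "continuous_on UNIV v" and bdd: "bdd_above (range v)" and K: "K > 0" and \<eta>: "\<eta> > 0"
  obtains z where "(K / smoothed_norm \<eta> (z - x)) *\<^sub>R (z - x) \<in> superdifferential v z"
    "\<And>y. v y - K * smoothed_norm \<eta> (y - x) \<le> v z - K * smoothed_norm \<eta> (z - x)"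
proof -
  obtain B where B: "\<And>y. v y \<le> B" using bdd unfolding bdd_above_def by auto
  define f where "f z = v z - K * smoothed_norm \<eta> (z - x)" for z
  define \<rho> where "\<rho> = (B - v x + K * \<eta>) / K"
  have \<rho>: "\<rho> \<ge> 0" using B[of x] K \<eta> by (simp add: \<rho>_def)
  have dominated: "\<exists>k\<in>cball x \<rho>. f w \<le> f k" for w
  proof (cases "w \<in> cball x \<rho>")
    case False
    then have "\<rho> \<le> smoothed_norm \<eta> (w - x)"
      using norm_le_smoothed_norm[of "w - x" \<eta>] by (simp add: dist_norm norm_minus_commute)
    then have "K * \<rho> \<le> K * smoothed_norm \<eta> (w - x)" using K by simp
    then have "f w \<le> f x"
      using B[of w] K \<eta> by (simp add: f_def \<rho>_def smoothed_norm_0)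
    then show ?thesis using \<rho> by (intro bexI[of _ x]) auto
  qed blast
  have "continuous_on (cball x \<rho>) f"
    unfolding f_def using has_continuous_gradient_smoothed_norm[OF \<eta>]
    by (intro continuous_on_diff continuous_on_subset[OF cont]
        has_continuous_gradient_imp_continuous_on) auto
  from continuous_attains_global_max[OF compact_cball this dominated]
  obtain z where z: "\<And>w. f w \<le> f z" by blast
  show ?thesis
  proof
    show "(K / smoothed_norm \<eta> (z - x)) *\<^sub>R (z - x) \<in> superdifferential v z"
      by (rule superdifferentialI[OF has_continuous_gradient_smoothed_norm[OF \<eta>] _ refl])
        (use z in \<open>simp add: f_def\<close>)
    show "v y - K * smoothed_norm \<eta> (y - x) \<le> v z - K * smoothed_norm \<eta> (z - x)" for y
      using z[of y] by (simp add: f_def)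
  qed
qed

text \<open>
  A cone of slope larger than \<open>R\<close> with smoothed vertex \<open>x\<close> can touch \<open>v\<close> only near \<open>x\<close>. The slope
  \<open>sqrt (R\<^sup>2 + \<eta>)\<close> lets it tend to \<open>R\<close> together with the smoothing parameter \<open>\<eta>\<close>.
\<close>

lemma superdifferential_bound_steep_cone:
  fixes v :: "'a::euclidean_space \<Rightarrow> real"
  assumes cont: "continuous_on UNIV v" and bdd: "bdd_above (range v)" and \<eta>: "\<eta> > 0"
    and bound: "\<And>y p. p \<in> superdifferential v y \<Longrightarrow> norm p \<le> R"
  shows "\<exists>z. (norm (z - x))\<^sup>2 \<le> R\<^sup>2 * \<eta> \<and>
    v y - sqrt (R\<^sup>2 + \<eta>) * smoothed_norm \<eta> (y - x) \<le> v z"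
proof -
  define K where "K = sqrt (R\<^sup>2 + \<eta>)"
  have K: "K > 0" using \<eta> by (simp add: K_def add_nonneg_pos)
  obtain z where z: "(K / smoothed_norm \<eta> (z - x)) *\<^sub>R (z - x) \<in> superdifferential v z"
    and z_max: "v y - K * smoothed_norm \<eta> (y - x) \<le> v z - K * smoothed_norm \<eta> (z - x)"
    using superdifferential_smoothed_cone[OF cont bdd K \<eta>] by metis
  have pos: "smoothed_norm \<eta> (z - x) > 0" using \<eta> by (rule smoothed_norm_pos)
  have "K * norm (z - x) \<le> R * smoothed_norm \<eta> (z - x)"
    using bound[OF z] K pos by (simp add: divide_le_eq)
  then have "(K * norm (z - x))\<^sup>2 \<le> (R * smoothed_norm \<eta> (z - x))\<^sup>2"
    using K by (intro power_mono) auto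
  then have "\<eta> * (norm (z - x))\<^sup>2 \<le> \<eta> * (R\<^sup>2 * \<eta>)"
    using \<eta> by (simp add: K_def smoothed_norm_def power_mult_distrib power2_eq_square[of \<eta>]
        algebra_simps)
  then have "(norm (z - x))\<^sup>2 \<le> R\<^sup>2 * \<eta>" using \<eta> by simp
  moreover have "v y - K * smoothed_norm \<eta> (y - x) \<le> v z"
    using z_max mult_pos_pos[OF K pos] by linarith
  ultimately show ?thesis unfolding K_def by blast
qed

lemma superdifferential_bound_imp_lipschitz:
  fixes v :: "'a::euclidean_space \<Rightarrow> real"
  assumes cont: "continuous_on UNIV v" and bdd: "bdd_above (range v)" and R: "R \<ge> 0"
    and bound: "\<And>y p. p \<in> superdifferential v y \<Longrightarrow> norm p \<le> R"
  shows "R-lipschitz_on UNIV v"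
proof -
  have one_sided: "v y \<le> v x + R * norm (y - x)" for x y
  proof -
    have "\<exists>z. (norm (z - x))\<^sup>2 \<le> R\<^sup>2 * \<eta> \<and>
        v y - sqrt (R\<^sup>2 + \<eta>) * smoothed_norm \<eta> (y - x) \<le> v z" if "\<eta> > 0" for \<eta>
      by (rule superdifferential_bound_steep_cone[OF cont bdd that bound])
    then obtain z where z: "\<And>\<eta>. \<eta> > 0 \<Longrightarrow> (norm (z \<eta> - x))\<^sup>2 \<le> R\<^sup>2 * \<eta>"
      and v_z: "\<And>\<eta>. \<eta> > 0 \<Longrightarrow> v y - sqrt (R\<^sup>2 + \<eta>) * smoothed_norm \<eta> (y - x) \<le> v (z \<eta>)"
      by metis
    have pos: "\<forall>\<^sub>F \<eta> in at_right 0. (0::real) < \<eta>" by (rule eventually_at_right_less)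
    have "((\<lambda>\<eta>. R\<^sup>2 * \<eta>) \<longlongrightarrow> R\<^sup>2 * 0) (at_right 0)" by (intro tendsto_intros)
    then have upper_lim: "((\<lambda>\<eta>. R\<^sup>2 * \<eta>) \<longlongrightarrow> 0) (at_right 0)" by simp
    have "((\<lambda>\<eta>. (norm (z \<eta> - x))\<^sup>2) \<longlongrightarrow> 0) (at_right 0)"
      by (rule tendsto_sandwich[OF always_eventually eventually_mono[OF pos z] tendsto_const
            upper_lim]) simp
    then have "((\<lambda>\<eta>. sqrt ((norm (z \<eta> - x))\<^sup>2)) \<longlongrightarrow> sqrt 0) (at_right 0)"
      by (rule tendsto_real_sqrt)
    then have "(z \<longlongrightarrow> x) (at_right 0)" by (simp add: tendsto_norm_zero_iff LIM_zero_iff)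
    then have v_lim: "((\<lambda>\<eta>. v (z \<eta>)) \<longlongrightarrow> v x) (at_right 0)"
      by (intro continuous_on_tendsto_compose[OF cont]) auto
    have "((\<lambda>\<eta>. v y - sqrt (R\<^sup>2 + \<eta>) * smoothed_norm \<eta> (y - x)) \<longlongrightarrow>
        v y - sqrt (R\<^sup>2 + 0) * sqrt ((norm (y - x))\<^sup>2 + 0\<^sup>2)) (at_right 0)"
      unfolding smoothed_norm_def by (intro tendsto_intros)
    from tendsto_le[OF _ v_lim this eventually_mono[OF pos v_z]] R show ?thesis by simp
  qed
  show ?thesis
  proof (rule lipschitz_onI)
    fix x y show "dist (v x) (v y) \<le> R * dist x y"
      using one_sided[of x y] one_sided[of y x]
      by (simp add: dist_real_def dist_norm norm_minus_commute abs_le_iff)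
  qed (rule R)
qed

section \<open>Perron's method\<close>

definition max_in_ball :: "'a::metric_space \<Rightarrow> real \<Rightarrow> ('a \<Rightarrow> real) \<Rightarrow> ('a \<Rightarrow> real) \<Rightarrow> 'a \<Rightarrow> real" where
  "max_in_ball y r u w z = (if z \<in> ball y r then max (u z) (w z) else u z)"

lemma continuous_on_max_in_ball:
  assumes u: "continuous_on UNIV u" and w: "continuous_on UNIV w" and s: "s < r"
    and annulus: "\<And>z. s < dist y z \<Longrightarrow> dist y z < r \<Longrightarrow> w z \<le> u z"
  shows "continuous_on UNIV (max_in_ball y r u w)"
proof -
  have "continuous_on (ball y r) (\<lambda>z. max (u z) (w z))"
    by (intro continuous_intros continuous_on_subset[OF u] continuous_on_subset[OF w]) auto
  then have "continuous_on (ball y r) (max_in_ball y r u w)"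
    by (rule continuous_on_eq) (simp add: max_in_ball_def)
  moreover have "continuous_on (- cball y s) (max_in_ball y r u w)"
    by (rule continuous_on_eq[OF continuous_on_subset[OF u]])
      (auto simp: max_in_ball_def max_absorb1 annulus)
  ultimately have "continuous_on (ball y r \<union> - cball y s) (max_in_ball y r u w)"
    by (intro continuous_on_open_Un) auto
  moreover have "ball y r \<union> - cball y s = UNIV" using s by auto
  ultimately show ?thesis by simp
qed

lemma viscosity_subsolution_max_in_ball:
  assumes u: "continuous_on UNIV u" "viscosity_subsolution F u"
    and w: "has_continuous_gradient w D" and s: "s < r"
    and annulus: "\<And>z. s < dist y z \<Longrightarrow> dist y z < r \<Longrightarrow> w z \<le> u z"
    and sub: "\<And>z. z \<in> ball y r \<Longrightarrow> F z (w z) (D z) \<le> 0"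
  shows "viscosity_subsolution F (max_in_ball y r u w)"
proof (rule viscosity_subsolutionI)
  show "continuous_on UNIV (max_in_ball y r u w)"
    using has_continuous_gradient_imp_continuous_on[OF w]
    by (rule continuous_on_max_in_ball[OF u(1) _ s annulus])
next
  fix z p assume p: "p \<in> superdifferential (max_in_ball y r u w) z"
  show "F z (max_in_ball y r u w z) p \<le> 0"
  proof (cases "max_in_ball y r u w z = u z")
    case True
    have "\<forall>\<^sub>F x in nhds z. u x \<le> max_in_ball y r u w x"
      by (auto simp: max_in_ball_def)
    from superdifferential_antimono[OF this True[symmetric]] p have "p \<in> superdifferential u z"
      by blast
    then show ?thesis unfolding True by (rule viscosity_subsolutionD[OF u(2)])
  next
    case False
    then have z: "z \<in> ball y r" and eq: "max_in_ball y r u w z = w z"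
      by (auto simp: max_in_ball_def max_def split: if_splits)
    have "\<forall>\<^sub>F x in nhds z. x \<in> ball y r" using z by (intro eventually_nhds_in_open) auto
    then have "\<forall>\<^sub>F x in nhds z. w x \<le> max_in_ball y r u w x"
      by (rule eventually_mono) (simp add: max_in_ball_def)
    from superdifferential_antimono[OF this eq[symmetric]] p have "p \<in> superdifferential w z"
      by blast
    then have "p = D z"
      using w by (intro superdifferential_GDERIV_unique) (auto simp: has_continuous_gradient_def)
    then show ?thesis using sub[OF z] eq by simp
  qed
qed

lemma strict_subsolution_stable:
  fixes F :: "'a::real_inner \<Rightarrow> real \<Rightarrow> 'a \<Rightarrow> real"
  assumes F_cont: "continuous_on UNIV (\<lambda>(y, r, q). F y r q)"
    and \<phi>: "has_continuous_gradient \<phi> D" and neg: "F y (\<phi> y) (D y) < 0"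
  obtains r \<kappa> where "r > 0" "\<kappa> > 0"
    "\<And>z s. z \<in> ball y r \<Longrightarrow> s \<in> ball 0 \<kappa> \<Longrightarrow> F z (\<phi> z + s) (D z) < 0"
proof -
  have \<phi>_fst: "continuous_on UNIV (\<lambda>x. \<phi> (fst x))" and D_fst: "continuous_on UNIV (\<lambda>x. D (fst x))"
    using \<phi> has_continuous_gradient_imp_continuous_on[OF \<phi>, of UNIV]
    by (auto simp: has_continuous_gradient_def intro!: continuous_on_compose2[of UNIV _ UNIV fst]
        continuous_intros)
  have "continuous_on UNIV (\<lambda>x. (fst x, \<phi> (fst x) + snd x, D (fst x)))"
    by (intro continuous_intros \<phi>_fst D_fst)
  from continuous_on_compose2[OF F_cont this]
  have "continuous_on UNIV (\<lambda>x. F (fst x) (\<phi> (fst x) + snd x) (D (fst x)))" by simp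
  then have "open {x. F (fst x) (\<phi> (fst x) + snd x) (D (fst x)) < 0}"
    by (rule open_Collect_less) (rule continuous_on_const)
  moreover have "(y, 0) \<in> {x. F (fst x) (\<phi> (fst x) + snd x) (D (fst x)) < 0}"
    using neg by simp
  ultimately obtain A B where AB: "open A" "open B" "(y, 0) \<in> A \<times> B"
    "A \<times> B \<subseteq> {x. F (fst x) (\<phi> (fst x) + snd x) (D (fst x)) < 0}"
    by (rule open_prod_elim)
  then obtain r \<kappa> where r: "r > 0" "ball y r \<subseteq> A" and \<kappa>: "\<kappa> > 0" "ball 0 \<kappa> \<subseteq> B"
    by (meson SigmaD1 SigmaD2 openE)
  show ?thesis
  proof (rule that[OF r(1) \<kappa>(1)])
    fix z and s :: real assume "z \<in> ball y r" "s \<in> ball 0 \<kappa>"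
    then have "(z, s) \<in> A \<times> B" using r(2) \<kappa>(2) by blast
    then show "F z (\<phi> z + s) (D z) < 0" using AB(4) by auto
  qed
qed

lemma raised_test_function:
  fixes F :: "'a::real_inner \<Rightarrow> real \<Rightarrow> 'a \<Rightarrow> real"
  assumes F_cont: "continuous_on UNIV (\<lambda>(y, r, q). F y r q)"
    and p: "p \<in> subdifferential u y" "F y (u y) p < 0" and \<epsilon>: "\<epsilon> > 0"
  obtains w D r where "has_continuous_gradient w D" "0 < r" "r \<le> \<epsilon>" "u y < w y"
    "\<And>z. z \<in> ball y r \<Longrightarrow> w z \<le> u z + \<epsilon>"
    "\<And>z. r / 2 < dist y z \<Longrightarrow> dist y z < r \<Longrightarrow> w z \<le> u z"
    "\<And>z. z \<in> ball y r \<Longrightarrow> F z (w z) (D z) < 0"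
proof -
  obtain \<phi> D \<rho> where \<phi>: "has_continuous_gradient \<phi> D" "\<phi> y = u y" "D y = p" and \<rho>: "\<rho> > 0"
    and contact: "\<And>z. dist z y < \<rho> \<Longrightarrow> \<phi> z + (norm (z - y))\<^sup>2 \<le> u z"
    using p(1) by (rule subdifferential_strict_contact) blast
  have "F y (\<phi> y) (D y) < 0" using p(2) \<phi> by simp
  with F_cont \<phi>(1) obtain \<sigma> \<tau> where pos: "\<sigma> > 0" "\<tau> > 0"
    and neg: "\<And>z s. z \<in> ball y \<sigma> \<Longrightarrow> s \<in> ball 0 \<tau> \<Longrightarrow> F z (\<phi> z + s) (D z) < 0"
    by (rule strict_subsolution_stable) blast
  define r where "r = min \<epsilon> (min \<rho> \<sigma>)"
  have r: "0 < r" "r \<le> \<epsilon>" "r \<le> \<rho>" "r \<le> \<sigma>" using \<epsilon> \<rho> pos by (auto simp: r_def)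
  define \<kappa> where "\<kappa> = min \<epsilon> (min (\<tau> / 2) ((r / 2)\<^sup>2))"
  have \<kappa>: "0 < \<kappa>" "\<kappa> \<le> \<epsilon>" "\<kappa> < \<tau>" "\<kappa> \<le> (r / 2)\<^sup>2"
    using \<epsilon> pos r(1) by (auto simp: \<kappa>_def min_less_iff_disj)
  have near: "\<phi> z + (norm (z - y))\<^sup>2 \<le> u z" if "z \<in> ball y r" for z
    using contact[of z] that r(3) by (simp add: dist_commute)
  show ?thesis
  proof (rule that[OF has_continuous_gradient_add_const[OF \<phi>(1), of \<kappa>] r(1,2)])
    show "u y < \<phi> y + \<kappa>" using \<phi>(2) \<kappa>(1) by simp
    show "\<phi> z + \<kappa> \<le> u z + \<epsilon>" if "z \<in> ball y r" for z
      using near[OF that] \<kappa>(2) zero_le_power2[of "norm (z - y)"] by linarith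
    show "\<phi> z + \<kappa> \<le> u z" if "r / 2 < dist y z" "dist y z < r" for z
    proof -
      have "(r / 2)\<^sup>2 \<le> (norm (z - y))\<^sup>2"
        using that r by (intro power_mono) (auto simp: dist_norm norm_minus_commute)
      moreover have "\<phi> z + (norm (z - y))\<^sup>2 \<le> u z" using that by (intro near) simp
      ultimately show ?thesis using \<kappa>(4) by linarith
    qed
    show "F z (\<phi> z + \<kappa>) (D z) < 0" if "z \<in> ball y r" for z
      using that r(4) \<kappa>(1,3) by (intro neg) auto
  qed
qed

text \<open>
  Where a subsolution fails to be a supersolution, its maximum with a slightly raised, strictly
  touching test function is a larger subsolution.
\<close>

lemma viscosity_subsolution_bump:
  fixes u :: "'a::euclidean_space \<Rightarrow> real"
  assumes F_cont: "continuous_on UNIV (\<lambda>(y, r, q). F y r q)"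
    and u: "continuous_on UNIV u" "viscosity_subsolution F u"
    and p: "p \<in> subdifferential u y" "F y (u y) p < 0" and \<epsilon>: "\<epsilon> > 0"
  obtains w where "continuous_on UNIV w" "viscosity_subsolution F w" "u y < w y"
    "\<And>z. u z \<le> w z" "\<And>z. w z \<le> u z + \<epsilon>" "\<And>z. z \<notin> ball y \<epsilon> \<Longrightarrow> w z = u z"
proof -
  obtain w D r where w: "has_continuous_gradient w D" and r: "0 < r" "r \<le> \<epsilon>" and above: "u y < w y"
    and upper: "\<And>z. z \<in> ball y r \<Longrightarrow> w z \<le> u z + \<epsilon>"
    and annulus: "\<And>z. r / 2 < dist y z \<Longrightarrow> dist y z < r \<Longrightarrow> w z \<le> u z"
    and sub: "\<And>z. z \<in> ball y r \<Longrightarrow> F z (w z) (D z) < 0"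
    using raised_test_function[OF F_cont p \<epsilon>] by blast
  have half: "r / 2 < r" using r(1) by simp
  show ?thesis
  proof (rule that[of "max_in_ball y r u w"])
    show "continuous_on UNIV (max_in_ball y r u w)"
      using has_continuous_gradient_imp_continuous_on[OF w]
      by (rule continuous_on_max_in_ball[OF u(1) _ half annulus])
    show "viscosity_subsolution F (max_in_ball y r u w)"
      by (rule viscosity_subsolution_max_in_ball[OF u w half annulus less_imp_le[OF sub]])
    show "u y < max_in_ball y r u w y" using r(1) above by (simp add: max_in_ball_def)
    show "u z \<le> max_in_ball y r u w z" for z by (simp add: max_in_ball_def)
    show "max_in_ball y r u w z \<le> u z + \<epsilon>" for z
      using upper[of z] \<epsilon> by (simp add: max_in_ball_def)
    show "max_in_ball y r u w z = u z" if "z \<notin> ball y \<epsilon>" for z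
      using that r(2) by (simp add: max_in_ball_def)
  qed
qed

lemma lipschitz_on_SUP:
  fixes S :: "('a::metric_space \<Rightarrow> real) set"
  assumes "S \<noteq> {}" and lipschitz: "\<And>v. v \<in> S \<Longrightarrow> L-lipschitz_on X v"
    and bdd: "\<And>x. x \<in> X \<Longrightarrow> bdd_above ((\<lambda>v. v x) ` S)"
  shows "L-lipschitz_on X (\<lambda>x. SUP v\<in>S. v x)"
proof -
  have one_sided: "(SUP v\<in>S. v x) \<le> (SUP v\<in>S. v y) + L * dist x y" if "x \<in> X" "y \<in> X" for x y
  proof (rule cSUP_least[OF assms(1)])
    fix v assume v: "v \<in> S"
    have "v x \<le> v y + L * dist x y"
      using lipschitz_onD[OF lipschitz[OF v] that] by (simp add: dist_real_def)
    also have "v y \<le> (SUP v\<in>S. v y)" by (rule cSUP_upper[OF v bdd[OF that(2)]])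
    finally show "v x \<le> (SUP v\<in>S. v y) + L * dist x y" by simp
  qed
  show ?thesis
  proof (rule lipschitz_onI)
    show "dist (SUP v\<in>S. v x) (SUP v\<in>S. v y) \<le> L * dist x y" if "x \<in> X" "y \<in> X" for x y
      using one_sided[OF that] one_sided[OF that(2,1)]
      by (simp add: dist_real_def dist_commute abs_le_iff)
    show "0 \<le> L" using assms(1) lipschitz lipschitz_on_nonneg by blast
  qed
qed

text \<open>
  Equi-Lipschitz subsolutions have a continuous supremum, so that no comparison principle is
  needed.
\<close>

locale perron_method =
  fixes F :: "'a::euclidean_space \<Rightarrow> real \<Rightarrow> 'a \<Rightarrow> real" and f g :: "'a \<Rightarrow> real" and L :: real
  assumes F_cont: "continuous_on UNIV (\<lambda>(y, r, q). F y r q)"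
    and f_cont: "continuous_on UNIV f" and f_subsolution: "viscosity_subsolution F f"
    and g_cont: "continuous_on UNIV g" and g_supersolution: "viscosity_supersolution F g"
    and f_le_g: "\<And>y. f y \<le> g y"
    and equi_lipschitz: "\<And>v. continuous_on UNIV v \<Longrightarrow> viscosity_subsolution F v \<Longrightarrow>
      (\<And>y. f y \<le> v y) \<Longrightarrow> (\<And>y. v y \<le> g y) \<Longrightarrow> L-lipschitz_on UNIV v"
begin

definition subsolutions :: "('a \<Rightarrow> real) set" where
  "subsolutions =
     {v. continuous_on UNIV v \<and> viscosity_subsolution F v \<and> (\<forall>y. f y \<le> v y \<and> v y \<le> g y)}"

definition solution :: "'a \<Rightarrow> real" where
  "solution y = (SUP v\<in>subsolutions. v y)"

lemma f_in_subsolutions: "f \<in> subsolutions"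
  using f_cont f_subsolution f_le_g by (simp add: subsolutions_def)

lemma subsolutions_bdd_above: "bdd_above ((\<lambda>v. v y) ` subsolutions)"
  by (rule bdd_aboveI2[of _ _ "g y"]) (simp add: subsolutions_def)

lemma le_solution: "v \<in> subsolutions \<Longrightarrow> v y \<le> solution y"
  unfolding solution_def by (rule cSUP_upper[OF _ subsolutions_bdd_above])

lemma solution_le: "(\<And>v. v \<in> subsolutions \<Longrightarrow> v y \<le> B) \<Longrightarrow> solution y \<le> B"
  unfolding solution_def using f_in_subsolutions by (intro cSUP_least) auto

lemma f_le_solution: "f y \<le> solution y"
  using f_in_subsolutions by (rule le_solution)

lemma solution_le_g: "solution y \<le> g y"
  by (rule solution_le) (simp add: subsolutions_def)

lemma solution_lipschitz: "L-lipschitz_on UNIV solution"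
proof -
  have "L-lipschitz_on UNIV (\<lambda>y. SUP v\<in>subsolutions. v y)"
    by (rule lipschitz_on_SUP[OF _ _ subsolutions_bdd_above])
      (use f_in_subsolutions equi_lipschitz in \<open>auto simp: subsolutions_def\<close>)
  then show ?thesis unfolding solution_def[abs_def] .
qed

lemma solution_continuous: "continuous_on UNIV solution"
  using solution_lipschitz by (rule lipschitz_on_continuous_on)

lemma solution_subsolution: "viscosity_subsolution F solution"
  by (rule viscosity_subsolution_SUP[OF F_cont _ _ _ subsolutions_bdd_above solution_def
        solution_continuous])
    (use f_in_subsolutions in \<open>auto simp: subsolutions_def\<close>)

lemma bump_in_subsolutions:
  assumes p: "p \<in> subdifferential solution y" "F y (solution y) p < 0"
    and less: "solution y < g y"
  obtains w where "w \<in> subsolutions" "solution y < w y"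
proof -
  define \<gamma> where "\<gamma> = (g y - solution y) / 2"
  have "continuous_on UNIV (\<lambda>z. solution z - g z)"
    by (intro continuous_intros solution_continuous g_cont)
  then have "\<forall>\<^sub>F z in nhds y. solution z - g z < - \<gamma>"
    by (rule continuous_on_imp_eventually_less) (use less in \<open>simp add: \<gamma>_def field_simps\<close>)
  then obtain d where d: "d > 0" "\<And>z. dist z y < d \<Longrightarrow> solution z + \<gamma> < g z"
    unfolding eventually_nhds_metric by force
  have \<gamma>: "\<gamma> > 0" using less by (simp add: \<gamma>_def)
  define \<epsilon> where "\<epsilon> = min \<gamma> d"
  have \<epsilon>: "0 < \<epsilon>" "\<epsilon> \<le> \<gamma>" "\<epsilon> \<le> d"
    using d(1) \<gamma> by (auto simp: \<epsilon>_def)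
  obtain w where w: "continuous_on UNIV w" "viscosity_subsolution F w" "solution y < w y"
    and bounds: "\<And>z. solution z \<le> w z" "\<And>z. w z \<le> solution z + \<epsilon>"
    and outside: "\<And>z. z \<notin> ball y \<epsilon> \<Longrightarrow> w z = solution z"
    using viscosity_subsolution_bump[OF F_cont solution_continuous solution_subsolution p \<epsilon>(1)]
    by blast
  have "w z \<le> g z" for z
  proof (cases "z \<in> ball y \<epsilon>")
    case True
    then show ?thesis using d(2)[of z] bounds(2)[of z] \<epsilon> by (simp add: dist_commute)
  qed (use outside solution_le_g in simp)
  moreover have "f z \<le> w z" for z using f_le_solution bounds(1) by (rule order_trans)
  ultimately have "w \<in> subsolutions" using w by (simp add: subsolutions_def)
  then show ?thesis using w(3) that by blast
qed

lemma solution_supersolution: "viscosity_supersolution F solution"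
proof (rule viscosity_supersolutionI[OF solution_continuous])
  fix y p assume p: "p \<in> subdifferential solution y"
  show "0 \<le> F y (solution y) p"
  proof (cases "solution y = g y")
    case True
    have "p \<in> subdifferential g y"
      using p subdifferential_mono[where u = solution and w = g and y = y] True solution_le_g
      by auto
    then show ?thesis unfolding True by (rule viscosity_supersolutionD[OF g_supersolution])
  next
    case False
    then have less: "solution y < g y" using solution_le_g[of y] by simp
    show ?thesis
    proof (rule ccontr)
      assume "\<not> ?thesis"
      then obtain w where "w \<in> subsolutions" "solution y < w y"
        using bump_in_subsolutions[OF p _ less] by auto
      then show False using le_solution[of w y] by simp
    qed
  qed
qed

lemma solution_translate_le:
  assumes "\<And>y r q. F (y + k) r q = F y r q" "\<And>y. f (y + k) = f y" "\<And>y. g (y + k) = g y"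
  shows "solution (y + k) \<le> solution y"
proof (rule solution_le)
  fix v assume v: "v \<in> subsolutions"
  then have "viscosity_subsolution F (\<lambda>y. v (y + k))"
    using assms(1) by (intro viscosity_subsolution_translate) (auto simp: subsolutions_def)
  moreover have "continuous_on UNIV (\<lambda>y. v (y + k))"
    using v by (intro continuous_on_compose2[of UNIV v UNIV "\<lambda>y. y + k"])
      (auto simp: subsolutions_def intro: continuous_intros)
  moreover have "f y \<le> v (y + k)" "v (y + k) \<le> g y" for y
    using v assms(2,3)[of y] by (auto simp: subsolutions_def) (metis, metis)
  ultimately have "(\<lambda>y. v (y + k)) \<in> subsolutions" by (simp add: subsolutions_def)
  from le_solution[OF this] show "v (y + k) \<le> solution y" .
qed

lemma solution_translate:
  assumes "\<And>y r q. F (y + k) r q = F y r q" "\<And>y. f (y + k) = f y" "\<And>y. g (y + k) = g y"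
  shows "solution (y + k) = solution y"
proof (rule antisym)
  show "solution (y + k) \<le> solution y" by (rule solution_translate_le[OF assms])
  have "solution (y + k + - k) \<le> solution (y + k)"
    by (rule solution_translate_le)
      (use assms(1)[of "_ - k"] assms(2)[of "_ - k"] assms(3)[of "_ - k"] in auto)
  then show "solution y \<le> solution (y + k)" by simp
qed

end

section \<open>The discounted equation\<close>

lemma discounted_subsolution_lipschitz:
  fixes G :: "'a::euclidean_space \<Rightarrow> 'a \<Rightarrow> real"
  assumes v: "continuous_on UNIV v" "viscosity_subsolution (\<lambda>y r q. \<delta> * r + G y q) v"
    and bdd: "bdd_above (range v)" and lower: "\<And>y. - M \<le> \<delta> * v y"
    and R: "\<And>y q. G y q \<le> M \<Longrightarrow> norm q \<le> R" "R \<ge> 0"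
  shows "R-lipschitz_on UNIV v"
proof (rule superdifferential_bound_imp_lipschitz[OF v(1) bdd R(2)])
  fix y p assume "p \<in> superdifferential v y"
  then have "\<delta> * v y + G y p \<le> 0" by (rule viscosity_subsolutionD[OF v(2)])
  then show "norm p \<le> R" using lower[of y] by (intro R(1)[of y]) linarith
qed

lemma discounted_problem_solvable:
  fixes G :: "'a::euclidean_space \<Rightarrow> 'a \<Rightarrow> real"
  assumes G_cont: "continuous_on UNIV (\<lambda>(y, q). G y q)" and \<delta>: "\<delta> > 0"
    and G_0: "\<And>y. \<bar>G y 0\<bar> \<le> M" and R: "\<And>y q. G y q \<le> M \<Longrightarrow> norm q \<le> R"
  obtains u where "viscosity_solution (\<lambda>y r q. \<delta> * r + G y q) u" "R-lipschitz_on UNIV u"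
    "\<And>y. \<bar>\<delta> * u y\<bar> \<le> M" "\<And>k y. (\<And>y q. G (y + k) q = G y q) \<Longrightarrow> u (y + k) = u y"
proof -
  let ?F = "\<lambda>y r q. \<delta> * r + G y q"
  have M: "M \<ge> 0" using G_0 by (meson abs_ge_zero order_trans)
  have R_nonneg: "R \<ge> 0" using R[of undefined 0] G_0[of undefined] by (simp add: abs_le_iff)
  interpret perron_method ?F "\<lambda>_. - (M / \<delta>)" "\<lambda>_. M / \<delta>" R
  proof
    have "continuous_on UNIV (\<lambda>x::'a \<times> real \<times> 'a. (fst x, snd (snd x)))"
      by (intro continuous_intros)
    from continuous_on_compose2[OF G_cont this]
    have "continuous_on UNIV (\<lambda>x::'a \<times> real \<times> 'a. G (fst x) (snd (snd x)))" by simp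
    then show "continuous_on UNIV (\<lambda>(y, r, q). ?F y r q)"
      unfolding case_prod_beta by (intro continuous_intros)
    have barrier: "?F y (- (M / \<delta>)) 0 \<le> 0" "0 \<le> ?F y (M / \<delta>) 0" for y
      using G_0[of y] \<delta> by auto
    show "viscosity_subsolution ?F (\<lambda>_. - (M / \<delta>))"
      by (rule viscosity_subsolution_const) (rule barrier)
    show "viscosity_supersolution ?F (\<lambda>_. M / \<delta>)"
      by (rule viscosity_supersolution_const) (rule barrier)
    show "- (M / \<delta>) \<le> M / \<delta>" using M \<delta> by simp
    show "R-lipschitz_on UNIV v" if "continuous_on UNIV v" "viscosity_subsolution ?F v"
      and "\<And>y. - (M / \<delta>) \<le> v y" "\<And>y. v y \<le> M / \<delta>" for v
    proof (rule discounted_subsolution_lipschitz[OF that(1,2) _ _ R R_nonneg])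
      show "bdd_above (range v)" using that(4) by (intro bdd_aboveI2)
      show "- M \<le> \<delta> * v y" for y using that(3)[of y] \<delta> by (simp add: field_simps)
    qed
  qed (rule continuous_on_const)+
  show ?thesis
  proof
    show "viscosity_solution ?F solution"
      using solution_subsolution solution_supersolution by (simp add: viscosity_solution_def)
    show "\<bar>\<delta> * solution y\<bar> \<le> M" for y
      using f_le_solution[of y] solution_le_g[of y] \<delta> by (simp add: abs_le_iff field_simps)
    show "solution (y + k) = solution y" if "\<And>y q. G (y + k) q = G y q" for k y
      by (rule solution_translate) (simp_all add: that)
  qed (rule solution_lipschitz)
qed

section \<open>Periodic functions\<close>

abbreviation unit_cube :: "(real ^ 'n) set" where
  "unit_cube \<equiv> cbox 0 1"

lemma Z_periodicD: "Z_periodic f \<Longrightarrow> (\<And>i. k $ i \<in> \<int>) \<Longrightarrow> f (y + k) = f y"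
  by (simp add: Z_periodic_def)

lemma unit_cube_representative:
  fixes y :: "real ^ 'n"
  obtains z where "z \<in> unit_cube" "\<And>f. Z_periodic f \<Longrightarrow> f y = f z"
proof
  let ?k = "(\<chi> i. of_int \<lfloor>y $ i\<rfloor>) :: real ^ 'n"
  show "y - ?k \<in> unit_cube"
    unfolding mem_box_cart
  proof
    fix i
    have "y $ i - of_int \<lfloor>y $ i\<rfloor> \<le> 1"
      using real_of_int_floor_add_one_ge[of "y $ i"] by linarith
    then show "(0 :: real ^ 'n) $ i \<le> (y - ?k) $ i \<and> (y - ?k) $ i \<le> (1 :: real ^ 'n) $ i"
      by simp
  qed
  show "f y = f (y - ?k)" if "Z_periodic f" for f
    using Z_periodicD[OF that, of ?k "y - ?k"] by simp
qed

lemma periodic_bounded_on_compact: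
  fixes G :: "real ^ 'n \<Rightarrow> 'a::topological_space \<Rightarrow> real"
  assumes G_cont: "continuous_on UNIV (\<lambda>(y, q). G y q)" and per: "\<And>q. Z_periodic (\<lambda>y. G y q)"
    and K: "compact K"
  obtains B where "\<And>y q. q \<in> K \<Longrightarrow> \<bar>G y q\<bar> \<le> B"
proof -
  have "compact ((\<lambda>(y, q). G y q) ` (unit_cube \<times> K))"
    by (intro compact_continuous_image continuous_on_subset[OF G_cont] compact_Times compact_cbox K)
      simp
  then have "bounded ((\<lambda>(y, q). G y q) ` (unit_cube \<times> K))" by (rule compact_imp_bounded)
  then obtain B where B: "\<And>y q. y \<in> unit_cube \<Longrightarrow> q \<in> K \<Longrightarrow> \<bar>G y q\<bar> \<le> B"
    unfolding bounded_real by fast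
  have "\<bar>G y q\<bar> \<le> B" if "q \<in> K" for y q
    using unit_cube_representative[of y] B[OF _ that] per[of q] by metis
  then show ?thesis by (rule that)
qed

lemma Z_periodic_limit:
  fixes v :: "nat \<Rightarrow> real ^ 'n \<Rightarrow> real"
  assumes "\<And>n. Z_periodic (v n)" and "\<And>y. (\<lambda>n. v n y) \<longlonglongrightarrow> \<psi> y"
  shows "Z_periodic \<psi>"
  unfolding Z_periodic_def
proof (intro allI impI)
  fix y k :: "real ^ 'n" assume "\<forall>i. k $ i \<in> \<int>"
  then have "(\<lambda>n. v n (y + k)) = (\<lambda>n. v n y)" using Z_periodicD[OF assms(1)] by simp
  then show "\<psi> (y + k) = \<psi> y" using assms(2)[of "y + k"] assms(2)[of y] LIMSEQ_unique by metis
qed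

lemma lipschitz_on_limit:
  fixes v :: "nat \<Rightarrow> 'a::metric_space \<Rightarrow> 'b::metric_space"
  assumes "\<And>n. L-lipschitz_on X (v n)" and "\<And>x. x \<in> X \<Longrightarrow> (\<lambda>n. v n x) \<longlonglongrightarrow> \<psi> x"
  shows "L-lipschitz_on X \<psi>"
proof (rule lipschitz_onI)
  show "dist (\<psi> x) (\<psi> y) \<le> L * dist x y" if "x \<in> X" "y \<in> X" for x y
    by (rule LIMSEQ_le_const2[OF tendsto_dist[OF assms(2)[OF that(1)] assms(2)[OF that(2)]]])
      (use lipschitz_onD[OF assms(1) that] in auto)
  show "0 \<le> L" using assms(1) by (rule lipschitz_on_nonneg)
qed

lemma uniform_limit_unit_cube_imp_UNIV:
  assumes per: "\<And>n. Z_periodic (v n)" and lim: "uniform_limit unit_cube v g F"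
  obtains \<psi> where "uniform_limit UNIV v \<psi> F"
proof -
  have "\<exists>z\<in>unit_cube. \<forall>n. v n y = v n z" for y
    using unit_cube_representative[of y] per by metis
  then obtain rep where rep: "\<And>y. rep y \<in> unit_cube" "\<And>n y. v n y = v n (rep y)" by metis
  have "uniform_limit UNIV v (\<lambda>y. g (rep y)) F"
  proof (rule uniform_limitI)
    fix e :: real assume "e > 0"
    from uniform_limitD[OF lim this] show "\<forall>\<^sub>F n in F. \<forall>y\<in>UNIV. dist (v n y) (g (rep y)) < e"
      by (rule eventually_mono) (use rep in metis)
  qed
  then show ?thesis by (rule that)
qed

lemma periodic_Arzela_Ascoli:
  fixes v :: "nat \<Rightarrow> real ^ 'n \<Rightarrow> real"
  assumes per: "\<And>n. Z_periodic (v n)" and lipschitz: "\<And>n. L-lipschitz_on UNIV (v n)"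
    and bound: "\<And>n. \<bar>v n 0\<bar> \<le> B"
  obtains \<psi> r where "strict_mono r" "uniform_limit UNIV (\<lambda>n. v (r n)) \<psi> sequentially"
    "Z_periodic \<psi>" "L-lipschitz_on UNIV \<psi>"
proof -
  have L: "L \<ge> 0" using lipschitz by (rule lipschitz_on_nonneg)
  have lip: "\<bar>v n x - v n y\<bar> \<le> L * norm (x - y)" for n x y
    using lipschitz_onD[OF lipschitz, of x y n] by (simp add: dist_norm)
  obtain D :: real where D: "\<And>y :: real ^ 'n. y \<in> unit_cube \<Longrightarrow> norm y \<le> D"
    using bounded_cbox[of "0 :: real ^ 'n" 1] unfolding bounded_iff by blast
  have "norm (v n y) \<le> B + L * D" if "y \<in> unit_cube" for n y
    using lip[of n y 0] bound[of n] mult_left_mono[OF D[OF that] L] by simp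
  moreover have "\<exists>d>0. \<forall>n y. y \<in> unit_cube \<and> norm (x - y) < d \<longrightarrow> norm (v n x - v n y) < e"
    if e: "e > 0" for x e
  proof (intro exI[of _ "e / (L + 1)"] conjI allI impI)
    fix n y assume "y \<in> unit_cube \<and> norm (x - y) < e / (L + 1)"
    then have "(L + 1) * norm (x - y) < e" using L by (simp add: field_simps)
    moreover have "L * norm (x - y) \<le> (L + 1) * norm (x - y)" by (intro mult_right_mono) auto
    ultimately show "norm (v n x - v n y) < e" using lip[of n x y] by simp
  qed (use e L in simp)
  ultimately obtain g r where "continuous_on unit_cube g" and r: "strict_mono (r :: nat \<Rightarrow> nat)"
    and g: "\<And>e. 0 < e \<Longrightarrow> \<exists>N. \<forall>n x. n \<ge> N \<and> x \<in> unit_cube \<longrightarrow> norm (v (r n) x - g x) < e"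
    using Arzela_Ascoli[of "unit_cube :: (real ^ 'n) set" v "B + L * D"] by (metis compact_cbox)
  have "uniform_limit unit_cube (\<lambda>n. v (r n)) g sequentially"
  proof (rule uniform_limitI)
    fix e :: real assume "e > 0"
    from g[OF this] show "\<forall>\<^sub>F n in sequentially. \<forall>y\<in>unit_cube. dist (v (r n) y) (g y) < e"
      unfolding eventually_sequentially dist_norm by blast
  qed
  with per obtain \<psi> where lim: "uniform_limit UNIV (\<lambda>n. v (r n)) \<psi> sequentially"
    by (rule uniform_limit_unit_cube_imp_UNIV)
  then have pointwise: "(\<lambda>n. v (r n) y) \<longlonglongrightarrow> \<psi> y" for y
    by (rule tendsto_uniform_limitI) simp
  show ?thesis
    by (rule that[OF r lim Z_periodic_limit[OF per pointwise]
          lipschitz_on_limit[OF lipschitz pointwise]])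
qed

section \<open>Uniqueness of the constant\<close>

lemma doubling_variables_attains_max:
  fixes u v :: "real ^ 'n \<Rightarrow> real"
  assumes u: "Z_periodic u" "continuous_on UNIV u" and v: "Z_periodic v" "L-lipschitz_on UNIV v"
    and N: "N > 0"
  obtains y w where "y \<in> unit_cube" "norm w \<le> L / N"
    "\<And>y' w'. u y' - v (y' - w') - N * (norm w')\<^sup>2 \<le> u y - v (y - w) - N * (norm w)\<^sup>2"
proof -
  define \<Phi> where "\<Phi> x = u (fst x) - v (fst x - snd x) - N * (norm (snd x))\<^sup>2" for x
  define K where "K = (unit_cube :: (real ^ 'n) set) \<times> cball (0 :: real ^ 'n) (L / N)"
  have L: "L \<ge> 0" using v(2) by (rule lipschitz_on_nonneg)
  have v_cont: "continuous_on UNIV v" using v(2) by (rule lipschitz_on_continuous_on)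
  have "continuous_on K (\<lambda>x. u (fst x))" "continuous_on K (\<lambda>x. v (fst x - snd x))"
    by (rule continuous_on_compose2[OF u(2)] continuous_on_compose2[OF v_cont];
      auto intro!: continuous_intros)+
  then have \<Phi>_cont: "continuous_on K \<Phi>" unfolding \<Phi>_def by (intro continuous_intros)
  have large_w: "\<Phi> (y, w) \<le> \<Phi> (y, 0)" if "L / N < norm w" for y w
  proof -
    have "v y - v (y - w) \<le> L * norm w"
      using lipschitz_onD[OF v(2), of y "y - w"] by (simp add: dist_norm abs_le_iff)
    also have "L * norm w \<le> (N * norm w) * norm w"
      using that N by (intro mult_right_mono) (auto simp: field_simps)
    finally show ?thesis by (simp add: \<Phi>_def power2_eq_square mult.assoc)
  qed
  have dominated: "\<exists>k\<in>K. \<Phi> x \<le> \<Phi> k" for x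
  proof -
    obtain z where z: "z \<in> unit_cube" "\<And>f. Z_periodic f \<Longrightarrow> f (fst x) = f z"
      by (rule unit_cube_representative[of "fst x"]) blast
    have "Z_periodic (\<lambda>y. \<Phi> (y, snd x))"
      using u(1) v(1) by (simp add: \<Phi>_def Z_periodic_def add_diff_eq diff_add_eq[symmetric])
    then have "\<Phi> x = \<Phi> (z, snd x)" using z(2)[of "\<lambda>y. \<Phi> (y, snd x)"] by simp
    moreover have "(z, snd x) \<in> K \<or> (z, 0) \<in> K \<and> \<Phi> (z, snd x) \<le> \<Phi> (z, 0)"
      using z(1) large_w[of "snd x" z] L N by (cases "norm (snd x) \<le> L / N") (auto simp: K_def)
    ultimately show ?thesis by (metis order_refl)
  qed
  have "compact K" unfolding K_def by (intro compact_Times compact_cbox compact_cball)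
  from continuous_attains_global_max[OF this \<Phi>_cont dominated]
  obtain k where k: "k \<in> K" "\<And>x. \<Phi> x \<le> \<Phi> k" by blast
  show ?thesis
    by (rule that[of "fst k" "snd k"]) (use k(1) k(2)[of "(_, _)"] in \<open>auto simp: K_def \<Phi>_def\<close>)
qed

lemma doubling_variables:
  fixes u v :: "real ^ 'n \<Rightarrow> real"
  assumes u: "Z_periodic u" "continuous_on UNIV u" and v: "Z_periodic v" "L-lipschitz_on UNIV v"
    and N: "N > 0"
  obtains y w where "y \<in> unit_cube" "norm w \<le> L / N"
    "(2 * N) *\<^sub>R w \<in> superdifferential u y" "(2 * N) *\<^sub>R w \<in> subdifferential v (y - w)"
proof -
  obtain y w where yw: "y \<in> unit_cube" "norm w \<le> L / N"
    and max: "\<And>y' w'. u y' - v (y' - w') - N * (norm w')\<^sup>2 \<le> u y - v (y - w) - N * (norm w)\<^sup>2"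
    by (rule doubling_variables_attains_max[OF u v N]) blast
  show ?thesis
  proof (rule that[OF yw])
    have "u x - N * (norm (x - (y - w)))\<^sup>2 \<le> u y - N * (norm (y - (y - w)))\<^sup>2" for x
      using max[of x "x - (y - w)"] by simp
    then show "(2 * N) *\<^sub>R w \<in> superdifferential u y"
      by (intro superdifferentialI[OF has_continuous_gradient_quadratic[of N "y - w"]]) auto
    have "v (y - w) - - N * (norm (y - w - y))\<^sup>2 \<le> v x - - N * (norm (x - y))\<^sup>2" for x
      using max[of y "y - x"] by (simp add: norm_minus_commute)
    then show "(2 * N) *\<^sub>R w \<in> subdifferential v (y - w)"
      by (intro subdifferentialI[OF has_continuous_gradient_quadratic[of "- N" y]]) auto
  qed
qed

lemma viscosity_comparison_of_constants:
  fixes G :: "real ^ 'n \<Rightarrow> real ^ 'n \<Rightarrow> real"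
  assumes G_cont: "continuous_on UNIV (\<lambda>(y, q). G y q)"
    and u: "Z_periodic u" "continuous_on UNIV u" "viscosity_subsolution (\<lambda>y r q. G y q - c) u"
    and v: "Z_periodic v" "L-lipschitz_on UNIV v" "viscosity_supersolution (\<lambda>y r q. G y q - d) v"
  shows "d \<le> c"
proof (rule field_le_epsilon)
  fix e :: real assume e: "e > 0"
  have L: "L \<ge> 0" using v(2) by (rule lipschitz_on_nonneg)
  obtain D :: real where D: "\<And>y :: real ^ 'n. y \<in> unit_cube \<Longrightarrow> norm y \<le> D"
    using bounded_cbox[of "0 :: real ^ 'n" 1] unfolding bounded_iff by blast
  let ?K = "cball (0 :: real ^ 'n) (D + L) \<times> cball (0 :: real ^ 'n) (2 * L)"
  have "uniformly_continuous_on ?K (\<lambda>(y, q). G y q)"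
    by (intro compact_uniformly_continuous continuous_on_subset[OF G_cont] compact_Times
        compact_cball) simp
  then obtain \<eta> where \<eta>: "\<eta> > 0" "\<And>y q y' q'. (y, q) \<in> ?K \<Longrightarrow> (y', q') \<in> ?K \<Longrightarrow>
      dist (y', q') (y, q) < \<eta> \<Longrightarrow> \<bar>G y' q' - G y q\<bar> < e"
    using e unfolding uniformly_continuous_on_def dist_real_def by (metis case_prod_conv)
  define N where "N = max 1 ((L + 1) / \<eta>)"
  have N: "N \<ge> 1" "L / N < \<eta>"
    using \<eta>(1) L by (auto simp: N_def field_simps max_def)
  obtain y w where yw: "y \<in> unit_cube" "norm w \<le> L / N"
    and p: "(2 * N) *\<^sub>R w \<in> superdifferential u y" "(2 * N) *\<^sub>R w \<in> subdifferential v (y - w)"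
    using doubling_variables[OF u(1,2) v(1,2), of N] N by auto
  let ?p = "(2 * N) *\<^sub>R w"
  have Nw: "N * norm w \<le> L" using yw(2) N by (simp add: field_simps)
  have "norm w \<le> L" using Nw N mult_right_mono[of 1 N "norm w"] by simp
  then have "(y, ?p) \<in> ?K" "(y - w, ?p) \<in> ?K"
    using D[OF yw(1)] norm_triangle_ineq4[of y w] Nw N L by auto
  moreover have "dist (y - w, ?p) (y, ?p) < \<eta>"
    using yw(2) N by (simp add: dist_Pair_Pair dist_norm)
  ultimately have "\<bar>G (y - w) ?p - G y ?p\<bar> < e" by (rule \<eta>(2))
  moreover have "G y ?p \<le> c" using viscosity_subsolutionD[OF u(3) p(1)] by simp
  moreover have "d \<le> G (y - w) ?p" using viscosity_supersolutionD[OF v(3) p(2)] by simp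
  ultimately show "d \<le> c + e" by linarith
qed

section \<open>The cell problem for a coercive periodic Hamiltonian\<close>

definition uniformly_coercive :: "('b \<Rightarrow> 'a::real_normed_vector \<Rightarrow> real) \<Rightarrow> bool" where
  "uniformly_coercive G \<longleftrightarrow> (\<forall>K. \<exists>R. \<forall>y q. G y q \<le> K \<longrightarrow> norm q \<le> R)"

definition cell_solution ::
    "(real ^ 'n \<Rightarrow> real ^ 'n \<Rightarrow> real) \<Rightarrow> real \<Rightarrow> (real ^ 'n \<Rightarrow> real) \<Rightarrow> bool" where
  "cell_solution G c \<psi> \<longleftrightarrow> Z_periodic \<psi> \<and> (\<exists>L. L-lipschitz_on UNIV \<psi>) \<and>
     viscosity_solution (\<lambda>y r q. G y q - c) \<psi>"

lemma vanishing_discount: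
  fixes G :: "'a::euclidean_space \<Rightarrow> 'a \<Rightarrow> real"
  assumes G_cont: "continuous_on UNIV (\<lambda>(y, q). G y q)"
    and u: "\<And>n. continuous_on UNIV (u n)"
      "\<And>n. viscosity_solution (\<lambda>y r q. \<delta> n * r + G y q) (u n)"
    and \<delta>_lim: "\<delta> \<longlonglongrightarrow> 0" and c_lim: "(\<lambda>n. \<delta> n * k n) \<longlonglongrightarrow> - c"
    and \<psi>_lim: "uniform_limit UNIV (\<lambda>n y. u n y - k n) \<psi> sequentially"
  shows "viscosity_solution (\<lambda>y r q. G y q - c) \<psi>"
proof -
  let ?F = "\<lambda>n y r q. \<delta> n * (r + k n) + G y q"
  have F_lim: "(\<lambda>n. ?F n (z n) (r n) (q n)) \<longlonglongrightarrow> G y p - c"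
    if "z \<longlonglongrightarrow> y" "r \<longlonglongrightarrow> s" "q \<longlonglongrightarrow> p" for z r q y p and s :: real
  proof -
    have "(\<lambda>n. G (z n) (q n)) \<longlonglongrightarrow> G y p"
      using continuous_on_tendsto_compose[OF G_cont tendsto_Pair[OF that(1,3)]] by simp
    then have "(\<lambda>n. \<delta> n * r n + \<delta> n * k n + G (z n) (q n)) \<longlonglongrightarrow> 0 * s + - c + G y p"
      by (intro tendsto_intros \<delta>_lim c_lim that(2))
    then show ?thesis by (simp add: algebra_simps)
  qed
  have cont: "continuous_on UNIV (\<lambda>y. u n y - k n)" for n by (intro continuous_intros u)
  have sub: "viscosity_subsolution (?F n) (\<lambda>y. u n y - k n)" for n
    using viscosity_subsolution_diff_const[OF u(1), of "\<lambda>y r q. \<delta> n * r + G y q" n "k n"]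
      u(2)[of n] by (simp add: viscosity_solution_def)
  have super: "viscosity_supersolution (?F n) (\<lambda>y. u n y - k n)" for n
    using viscosity_supersolution_diff_const[OF u(1), of "\<lambda>y r q. \<delta> n * r + G y q" n "k n"]
      u(2)[of n] by (simp add: viscosity_solution_def)
  show ?thesis
    unfolding viscosity_solution_def
    by (intro conjI viscosity_subsolution_uniform_limit[OF cont sub \<psi>_lim]
        viscosity_supersolution_uniform_limit[OF cont super \<psi>_lim] F_lim)
qed

lemma periodic_discounted_problem_solvable:
  fixes G :: "real ^ 'n \<Rightarrow> real ^ 'n \<Rightarrow> real"
  assumes G_cont: "continuous_on UNIV (\<lambda>(y, q). G y q)"
    and per: "\<And>q. Z_periodic (\<lambda>y. G y q)" and coercive: "uniformly_coercive G"
  obtains R M where "\<And>\<delta>. \<delta> > 0 \<Longrightarrow> \<exists>u. viscosity_solution (\<lambda>y r q. \<delta> * r + G y q) u \<and>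
    Z_periodic u \<and> R-lipschitz_on UNIV u \<and> (\<forall>y. \<bar>\<delta> * u y\<bar> \<le> M)"
proof -
  obtain M where M: "\<And>y. \<bar>G y 0\<bar> \<le> M"
    using periodic_bounded_on_compact[OF G_cont per compact_sing[of "0 :: real ^ 'n"]] by auto
  obtain R where R: "\<And>y q. G y q \<le> M \<Longrightarrow> norm q \<le> R"
    using coercive unfolding uniformly_coercive_def by blast
  show ?thesis
  proof (rule that[of R M])
    fix \<delta> :: real assume "\<delta> > 0"
    then show "\<exists>u. viscosity_solution (\<lambda>y r q. \<delta> * r + G y q) u \<and>
        Z_periodic u \<and> R-lipschitz_on UNIV u \<and> (\<forall>y. \<bar>\<delta> * u y\<bar> \<le> M)"
      by (rule discounted_problem_solvable[OF G_cont _ M R])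
        (use per in \<open>auto simp: Z_periodic_def\<close>)
  qed
qed

lemma cell_problem_solvable:
  fixes G :: "real ^ 'n \<Rightarrow> real ^ 'n \<Rightarrow> real"
  assumes G_cont: "continuous_on UNIV (\<lambda>(y, q). G y q)"
    and per: "\<And>q. Z_periodic (\<lambda>y. G y q)" and coercive: "uniformly_coercive G"
  shows "\<exists>c \<psi>. cell_solution G c \<psi>"
proof -
  define \<delta> where "\<delta> n = inverse (real (Suc n))" for n
  have \<delta>: "\<delta> n > 0" for n by (simp add: \<delta>_def)
  obtain M R where "\<And>\<delta>. \<delta> > 0 \<Longrightarrow> \<exists>u. viscosity_solution (\<lambda>y r q. \<delta> * r + G y q) u \<and>
      Z_periodic u \<and> R-lipschitz_on UNIV u \<and> (\<forall>y. \<bar>\<delta> * u y\<bar> \<le> M)"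
    by (rule periodic_discounted_problem_solvable[OF assms]) blast
  from this[OF \<delta>] obtain u where u: "\<And>n. viscosity_solution (\<lambda>y r q. \<delta> n * r + G y q) (u n)"
      "\<And>n. R-lipschitz_on UNIV (u n)" "\<And>n y. \<bar>\<delta> n * u n y\<bar> \<le> M" "\<And>n. Z_periodic (u n)"
    by metis
  have "\<forall>n. \<delta> n * u n 0 \<in> {- M..M}"
    using u(3)[of _ 0] by (simp add: abs_le_iff minus_le_iff)
  with compact_imp_seq_compact[OF compact_Icc[of "- M" M]] obtain d s
    where s: "strict_mono s" "((\<lambda>n. \<delta> n * u n 0) \<circ> s) \<longlonglongrightarrow> d"
    by (rule seq_compactE)
  define v where "v n y = u (s n) y - u (s n) 0" for n y
  have v_per: "Z_periodic (v n)" for n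
    using u(4) by (simp add: Z_periodic_def v_def)
  have v_lip: "R-lipschitz_on UNIV (v n)" for n
    using u(2)[of "s n"] by (simp add: lipschitz_on_def v_def dist_real_def)
  obtain \<psi> r where r: "strict_mono r" and \<psi>_lim: "uniform_limit UNIV (\<lambda>n. v (r n)) \<psi> sequentially"
    and \<psi>: "Z_periodic \<psi>" "R-lipschitz_on UNIV \<psi>"
    by (rule periodic_Arzela_Ascoli[OF v_per v_lip, where B = 0]) (auto simp: v_def)
  have "viscosity_solution (\<lambda>y r q. G y q - - d) \<psi>"
  proof (rule vanishing_discount[OF G_cont])
    show "continuous_on UNIV (u (s (r n)))" for n using u(2) by (rule lipschitz_on_continuous_on)
    show "viscosity_solution (\<lambda>y t q. \<delta> (s (r n)) * t + G y q) (u (s (r n)))" for n by (rule u(1))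
    have "\<delta> \<longlonglongrightarrow> 0" unfolding \<delta>_def by (rule LIMSEQ_inverse_real_of_nat)
    from LIMSEQ_subseq_LIMSEQ[OF this strict_mono_o[OF s(1) r]]
    show "(\<lambda>n. \<delta> (s (r n))) \<longlonglongrightarrow> 0" by (simp add: o_def)
    show "(\<lambda>n. \<delta> (s (r n)) * u (s (r n)) 0) \<longlonglongrightarrow> - (- d)"
      using LIMSEQ_subseq_LIMSEQ[OF s(2) r] by (simp add: o_def)
    show "uniform_limit UNIV (\<lambda>n y. u (s (r n)) y - u (s (r n)) 0) \<psi> sequentially"
      using \<psi>_lim by (simp add: v_def[abs_def])
  qed
  with \<psi> show ?thesis unfolding cell_solution_def by blast
qed

theorem cell_problem_unique_constant:
  fixes G :: "real ^ 'n \<Rightarrow> real ^ 'n \<Rightarrow> real"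
  assumes G_cont: "continuous_on UNIV (\<lambda>(y, q). G y q)"
    and per: "\<And>q. Z_periodic (\<lambda>y. G y q)" and coercive: "uniformly_coercive G"
  shows "\<exists>!c. \<exists>\<psi>. cell_solution G c \<psi>"
proof (rule ex_ex1I)
  show "\<exists>c \<psi>. cell_solution G c \<psi>" using assms by (rule cell_problem_solvable)
  have constants_le: "d \<le> c" if "cell_solution G c u" "cell_solution G d v" for c d u v
    using that viscosity_comparison_of_constants[OF G_cont, of u c v _ d]
    by (auto simp: cell_solution_def viscosity_solution_def lipschitz_on_continuous_on)
  show "c = d" if "\<exists>\<psi>. cell_solution G c \<psi>" "\<exists>\<psi>. cell_solution G d \<psi>" for c d
    using that constants_le by (blast intro: antisym)
qed

section \<open>Superlinear growth\<close>

definition superlinear_on_rays ::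
    "real \<Rightarrow> real \<Rightarrow> real \<Rightarrow> ('a::real_normed_vector \<Rightarrow> real) \<Rightarrow> bool" where
  "superlinear_on_rays b0 C0 m h \<longleftrightarrow> (\<forall>\<mu> p. 0 < \<mu> \<longrightarrow> \<mu> < 1 \<longrightarrow>
     (1 - \<mu>) * (b0 * norm p powr m - C0) \<le> \<mu> * h (inverse \<mu> *\<^sub>R p) - h p)"

lemma superlinear_on_raysD:
  assumes "superlinear_on_rays b0 C0 m h" and "0 < \<mu>" "\<mu> < 1"
  shows "(1 - \<mu>) * (b0 * norm p powr m - C0) \<le> \<mu> * h (inverse \<mu> *\<^sub>R p) - h p"
  using assms unfolding superlinear_on_rays_def by blast

lemma superlinear_imp_linear_lower_bound:
  fixes h :: "'a::real_normed_vector \<Rightarrow> real"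
  assumes super: "superlinear_on_rays b0 C0 m h"
    and b0: "b0 \<ge> 0" and C0: "C0 \<ge> 0" and sphere: "\<And>e. norm e = 1 \<Longrightarrow> - B \<le> h e"
    and p: "norm p \<ge> 1"
  shows "- (B + C0) * norm p \<le> h p"
proof (cases "norm p = 1")
  case True
  then show ?thesis using sphere[of p] C0 by simp
next
  case False
  define \<mu> where "\<mu> = inverse (norm p)"
  have "norm p > 1" using p False by simp
  then have \<mu>: "0 < \<mu>" "\<mu> < 1" by (auto simp: \<mu>_def inverse_less_1_iff)
  have norm_\<mu>: "norm p * \<mu> = 1" using p by (auto simp: \<mu>_def intro!: right_inverse)
  have unit: "norm (\<mu> *\<^sub>R p) = 1" "inverse \<mu> *\<^sub>R \<mu> *\<^sub>R p = p" using \<mu> by (auto simp: \<mu>_def)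
  have "(1 - \<mu>) * - C0 \<le> (1 - \<mu>) * (b0 - C0)" using \<mu> b0 by (intro mult_left_mono) auto
  also have "\<dots> \<le> \<mu> * h p - h (\<mu> *\<^sub>R p)"
    using superlinear_on_raysD[OF super \<mu>, of "\<mu> *\<^sub>R p"] unfolding unit by simp
  finally have "- (B + C0) \<le> \<mu> * h p"
    using sphere[OF unit(1)] mult_right_mono[of "1 - \<mu>" 1 C0] \<mu> C0 by simp
  then have "norm p * - (B + C0) \<le> norm p * (\<mu> * h p)" by (intro mult_left_mono) auto
  also have "\<dots> = h p" using norm_\<mu> by (simp add: mult.assoc[symmetric])
  finally show ?thesis by (simp add: mult.commute)
qed

lemma superlinear_lower_bound:
  fixes h :: "'a::real_normed_vector \<Rightarrow> real"
  assumes super: "superlinear_on_rays b0 C0 m h"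
    and b0: "b0 \<ge> 0" and C0: "C0 \<ge> 0" and sphere: "\<And>e. norm e = 1 \<Longrightarrow> - B \<le> h e"
    and p: "norm p \<ge> 2"
  shows "b0 * (norm p / 2) powr m - (B + C0) * norm p - C0 \<le> h p"
proof -
  have "- (B + C0) * norm ((1 / 2) *\<^sub>R p) \<le> h ((1 / 2) *\<^sub>R p)"
    by (rule superlinear_imp_linear_lower_bound[OF super b0 C0 sphere]) (use p in auto)
  moreover have "(1 / 2) * (b0 * (norm p / 2) powr m - C0) \<le> (1 / 2) * h p - h ((1 / 2) *\<^sub>R p)"
    using superlinear_on_raysD[OF super, of "1 / 2" "(1 / 2) *\<^sub>R p"] by simp
  ultimately show ?thesis by (simp add: field_simps)
qed

lemma superlinear_imp_uniformly_coercive: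
  fixes h :: "'b \<Rightarrow> 'a::real_normed_vector \<Rightarrow> real"
  assumes super: "\<And>y. superlinear_on_rays b0 C0 m (h y)"
    and b0: "b0 > 0" and C0: "C0 \<ge> 0" and m: "m > 1"
    and sphere: "\<And>y e. norm e = 1 \<Longrightarrow> - B \<le> h y e"
  shows "uniformly_coercive h"
  unfolding uniformly_coercive_def
proof
  fix K
  have "filterlim (\<lambda>s. b0 * (s / 2) powr m - (B + C0) * s - C0) at_top at_top"
    using b0 m by real_asymp
  then have "\<forall>\<^sub>F s in at_top. K < b0 * (s / 2) powr m - (B + C0) * s - C0"
    by (simp add: filterlim_at_top_dense)
  then obtain R where R: "\<And>s. s \<ge> R \<Longrightarrow> K < b0 * (s / 2) powr m - (B + C0) * s - C0"
    unfolding eventually_at_top_linorder by blast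
  have "norm q \<le> max 2 R" if "h y q \<le> K" for y q
  proof (rule ccontr)
    assume "\<not> ?thesis"
    then have "norm q \<ge> 2" "norm q \<ge> R" by auto
    then show False
      using superlinear_lower_bound[OF super less_imp_le[OF b0] C0 sphere, of q y]
        R[of "norm q"] that by fastforce
  qed
  then show "\<exists>R. \<forall>y q. h y q \<le> K \<longrightarrow> norm q \<le> R" by blast
qed

lemma periodic_superlinear_imp_uniformly_coercive:
  fixes h :: "real ^ 'n \<Rightarrow> 'a::euclidean_space \<Rightarrow> real"
  assumes cont: "continuous_on UNIV (\<lambda>(y, q). h y q)" and per: "\<And>q. Z_periodic (\<lambda>y. h y q)"
    and super: "\<And>y. superlinear_on_rays b0 C0 m (h y)"
    and b0: "b0 > 0" and C0: "C0 \<ge> 0" and m: "m > 1"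
  shows "uniformly_coercive h"
proof -
  obtain B where "\<And>y e. e \<in> sphere 0 1 \<Longrightarrow> \<bar>h y e\<bar> \<le> B"
    using periodic_bounded_on_compact[OF cont per compact_sphere] by blast
  then have sphere: "- B \<le> h y e" if "norm e = 1" for y e
    using that by (simp add: abs_le_iff minus_le_iff)
  show ?thesis by (rule superlinear_imp_uniformly_coercive[OF super b0 C0 m sphere])
qed

lemma uniformly_coercive_affine_perturbation:
  assumes coercive: "uniformly_coercive h" and b: "\<And>y. \<bar>b y\<bar> \<le> B"
  shows "uniformly_coercive (\<lambda>y q. b y + h y (p + q))"
  unfolding uniformly_coercive_def
proof
  fix K
  obtain R where R: "\<And>y q. h y q \<le> K + B \<Longrightarrow> norm q \<le> R"
    using coercive unfolding uniformly_coercive_def by blast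
  have "norm q \<le> R + norm p" if "b y + h y (p + q) \<le> K" for y q
  proof -
    have "h y (p + q) \<le> K + B" using that b[of y] by linarith
    from R[OF this] show ?thesis using norm_triangle_ineq4[of "p + q" p] by simp
  qed
  then show "\<exists>R. \<forall>y q. b y + h y (p + q) \<le> K \<longrightarrow> norm q \<le> R" by blast
qed

lemma continuous_on_curry:
  assumes "continuous_on UNIV (\<lambda>(x, z). f x z)"
  shows "continuous_on UNIV (f x)"
proof -
  have "continuous_on UNIV (\<lambda>z. (x, z))" by (intro continuous_intros)
  from continuous_on_compose2[OF assms this] show ?thesis by simp
qed

lemma continuous_on_affine_perturbation:
  fixes h :: "'b::topological_space \<Rightarrow> 'a::real_normed_vector \<Rightarrow> real"
  assumes "continuous_on UNIV (\<lambda>(y, q). h y q)" and b: "continuous_on UNIV b"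
  shows "continuous_on UNIV (\<lambda>(y, q). b y + h y (p + q))"
proof -
  have "continuous_on UNIV (\<lambda>z :: 'b \<times> 'a. (fst z, p + snd z))" by (intro continuous_intros)
  from continuous_on_compose2[OF assms(1) this]
  have "continuous_on UNIV (\<lambda>z. h (fst z) (p + snd z))" by simp
  moreover have "continuous_on UNIV (\<lambda>z :: 'b \<times> 'a. b (fst z))"
    by (rule continuous_on_compose2[OF b]) (auto intro: continuous_intros)
  ultimately show ?thesis unfolding case_prod_beta by (intro continuous_intros)
qed

theorem proposition6p1:
  fixes a :: "real ^ 'n \<Rightarrow> real ^ 'n \<Rightarrow> real"
    and H :: "real ^ 'n \<Rightarrow> real ^ 'n \<Rightarrow> real ^ 'n \<Rightarrow> real"
    and a0 b0 C0 m :: real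
    and \<omega> :: "real \<Rightarrow> real"
  assumes a_unif_cont: "uniformly_continuous_on UNIV (\<lambda>(x, y). a x y)"
    and H_cont: "continuous_on UNIV (\<lambda>(x, y, p). H x y p)"
    and a0_pos: "a0 > 0"
    and a_bounds: "\<And>x y. a0 \<le> a x y \<and> a x y \<le> inverse a0"
    and H0_bounded: "bounded (range (\<lambda>(x, y). H x y 0))"
    and a_bounded: "bounded (range (\<lambda>(x, y). a x y))"
    and a_periodic: "\<And>x. Z_periodic (a x)"
    and H_periodic: "\<And>x p. Z_periodic (\<lambda>y. H x y p)"
    and b0_pos: "b0 > 0" and C0_pos: "C0 > 0" and m_gt_1: "m > 1"
    and H_superlinear: "\<And>\<mu> x y p. 0 < \<mu> \<Longrightarrow> \<mu> < 1 \<Longrightarrow>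
      \<mu> * H x y (inverse \<mu> *\<^sub>R p) - H x y p \<ge> (1 - \<mu>) * (b0 * norm p powr m - C0)"
    and modulus: "modulus_of_continuity \<omega>"
    and H_regular: "\<And>R x x' y y' p p'. R > 0 \<Longrightarrow> norm p \<le> R \<Longrightarrow> norm p' \<le> R \<Longrightarrow>
      \<bar>H x y p - H x' y' p'\<bar> \<le>
        \<omega> (norm (x - x') + norm (y - y')) * (1 + R powr m)
        + \<omega> (norm (p - p')) * (1 + R powr (m - 1))"
  shows "\<forall>x p. \<forall>l::real. \<exists>!c. \<exists>\<psi>. Z_periodic \<psi> \<and> (\<exists>L. L-lipschitz_on UNIV \<psi>) \<and>
      viscosity_solution (\<lambda>y r q. - a x y * l + H x y (p + q) - c) \<psi>"
proof (intro allI)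
  fix x p :: "real ^ 'n" and l :: real
  let ?G = "\<lambda>y q. - a x y * l + H x y (p + q)"
  have a_cont: "continuous_on UNIV (a x)"
    using continuous_on_curry[OF uniformly_continuous_imp_continuous[OF a_unif_cont]] .
  have H_x_cont: "continuous_on UNIV (\<lambda>(y, q). H x y q)"
    using continuous_on_curry[OF H_cont] .
  obtain A where A: "\<And>y. \<bar>a x y\<bar> \<le> A"
    using a_bounded unfolding bounded_iff by fastforce
  have "superlinear_on_rays b0 C0 m (H x y)" for y
    using H_superlinear by (simp add: superlinear_on_rays_def)
  then have "uniformly_coercive (H x)"
    by (rule periodic_superlinear_imp_uniformly_coercive
        [OF H_x_cont H_periodic _ b0_pos less_imp_le[OF C0_pos] m_gt_1])
  moreover have "\<bar>- a x y * l\<bar> \<le> A * \<bar>l\<bar>" for y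
    using mult_right_mono[OF A, of "\<bar>l\<bar>"] by (simp add: abs_mult)
  ultimately have coercive: "uniformly_coercive ?G" by (rule uniformly_coercive_affine_perturbation)
  have cont: "continuous_on UNIV (\<lambda>(y, q). ?G y q)"
    by (intro continuous_on_affine_perturbation H_x_cont continuous_intros a_cont)
  have per: "Z_periodic (\<lambda>y. ?G y q)" for q
    using a_periodic[of x] H_periodic[of x "p + q"] by (simp add: Z_periodic_def)
  show "\<exists>!c. \<exists>\<psi>. Z_periodic \<psi> \<and> (\<exists>L. L-lipschitz_on UNIV \<psi>) \<and>
      viscosity_solution (\<lambda>y r q. ?G y q - c) \<psi>"
    using cell_problem_unique_constant[OF cont per coercive] unfolding cell_solution_def .
qed

end
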